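(* Let $r_1,r_2>0$ and let $H$ be a harmonic function on $\mathbb{R}^2$. For $\epsilon>0$ let $B_j=B(\mathbf{c}_j,r_j)$, $j=1,2$, be two open disks with centers $\mathbf{c}_j$ and radii $r_j$ whose closures are disjoint and whose distance is $\epsilon$. Let $u$ be the solution to $$\Delta u=0 \text{ in } \mathbb{R}^2\setminus\overline{B_1\cup B_2},\qquad u|_{\partial B_j}=\lambda_j \ (\text{constant}),\ j=1,2,\qquad u(\mathbf{x})-H(\mathbf{x})=O(|\mathbf{x}|^{-1}) \text{ as } |\mathbf{x}|\to\infty,$$ where the constants $\lambda_j$ are determined by $\int_{\partial B_j}\frac{\partial u}{\partial\nu}\big|_+\,ds=0$, $j=1,2$. Let $\mathbf{p}_1,\mathbf{p}_2,h,\mathbf{n},\mathbf{p}$ be as in the context. Then $$u(\mathbf{x})=a\,h(\mathbf{x})+b(\mathbf{x}),\qquad a=\frac{4\pi r_1r_2}{r_1+r_2}\,(\mathbf{n}\cdot\nabla H)(\mathbf{p}),$$ and for any bounded set $\Omega$ containing $\overline{B_1}$ and $\overline{B_2}$ there is a constant $C$ independent of $\epsilon$ such that $$\|\nabla b\|_{L^\infty(\Omega\setminus(B_1\cup B_2))}\le C.$$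
   Context: $\nu$ denotes the outward unit normal of $\mathbb{R}^2\setminus\overline{B_1\cup B_2}$ (directed into $B_j$ on $\partial B_j$), and $|_+$ denotes the limit from outside the disks. For $j=1,2$, $R_j(\mathbf{x})=\frac{r_j^2(\mathbf{x}-\mathbf{c}_j)}{|\mathbf{x}-\mathbf{c}_j|^2}+\mathbf{c}_j$ is the reflection with respect to $\partial B_j$. $\mathbf{p}_1$ is the unique fixed point of $R_1R_2$ and $\mathbf{p}_2$ the unique fixed point of $R_2R_1$. Define $h(\mathbf{x})=\frac{1}{2\pi}\left(\log|\mathbf{x}-\mathbf{p}_1|-\log|\mathbf{x}-\mathbf{p}_2|\right)$. $\mathbf{n}$ is the unit vector in the direction of $\mathbf{p}_2-\mathbf{p}_1$, and $\mathbf{p}$ is the midpoint of the shortest line segment connecting $\partial B_1$ and $\partial B_2$. The constant $C$ may depend on $r_1,r_2,H,\Omega$ but not on $\epsilon$. *)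

theory Defs
  imports "HOL-Analysis.Analysis"
begin

definition pd :: "2 \<Rightarrow> (real^2 \<Rightarrow> real) \<Rightarrow> real^2 \<Rightarrow> real" where
  "pd i f x = frechet_derivative f (at x) (axis i 1)"

definition grad :: "(real^2 \<Rightarrow> real) \<Rightarrow> real^2 \<Rightarrow> real^2" where
  "grad f x = (\<chi> i. pd i f x)"

definition harmonic_on :: "(real^2 \<Rightarrow> real) \<Rightarrow> (real^2) set \<Rightarrow> bool" where
  "harmonic_on f S \<longleftrightarrow> open S \<and> f differentiable_on S
     \<and> (\<forall>i. \<forall>x\<in>S. pd i f differentiable at x)
     \<and> (\<forall>i j. continuous_on S (pd j (pd i f)))
     \<and> (\<forall>x\<in>S. (\<Sum>i\<in>UNIV. pd i (pd i f) x) = 0)"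

definition refl_circ :: "real^2 \<Rightarrow> real \<Rightarrow> real^2 \<Rightarrow> real^2" where
  "refl_circ c r x = (r\<^sup>2 / (norm (x - c))\<^sup>2) *\<^sub>R (x - c) + c"

definition fixpt1 :: "real^2 \<Rightarrow> real \<Rightarrow> real^2 \<Rightarrow> real \<Rightarrow> real^2" where
  "fixpt1 c1 r1 c2 r2 = (THE x. x \<in> ball c1 r1 \<and> refl_circ c1 r1 (refl_circ c2 r2 x) = x)"

definition fixpt2 :: "real^2 \<Rightarrow> real \<Rightarrow> real^2 \<Rightarrow> real \<Rightarrow> real^2" where
  "fixpt2 c1 r1 c2 r2 = (THE x. x \<in> ball c2 r2 \<and> refl_circ c2 r2 (refl_circ c1 r1 x) = x)"

definition hfun :: "real^2 \<Rightarrow> real^2 \<Rightarrow> real^2 \<Rightarrow> real" where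
  "hfun p1 p2 x = (1 / (2 * pi)) * (ln (norm (x - p1)) - ln (norm (x - p2)))"

definition nvec :: "real^2 \<Rightarrow> real^2 \<Rightarrow> real^2" where
  "nvec p1 p2 = (1 / norm (p2 - p1)) *\<^sub>R (p2 - p1)"

text \<open>Midpoint of the shortest segment joining the two circles.\<close>
definition midpt :: "real^2 \<Rightarrow> real \<Rightarrow> real^2 \<Rightarrow> real \<Rightarrow> real^2" where
  "midpt c1 r1 c2 r2 =
     (let e = (1 / norm (c2 - c1)) *\<^sub>R (c2 - c1)
      in (1/2) *\<^sub>R ((c1 + r1 *\<^sub>R e) + (c2 - r2 *\<^sub>R e)))"

definition coef_a :: "real \<Rightarrow> real \<Rightarrow> real^2 \<Rightarrow> real^2 \<Rightarrow> (real^2 \<Rightarrow> real) \<Rightarrow> real" where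
  "coef_a r1 r2 c1 c2 H =
     4 * pi * r1 * r2 / (r1 + r2) *
     (nvec (fixpt1 c1 r1 c2 r2) (fixpt2 c1 r1 c2 r2) \<bullet> grad H (midpt c1 r1 c2 r2))"

definition circ :: "real^2 \<Rightarrow> real \<Rightarrow> real \<Rightarrow> real^2" where
  "circ c r t = c + r *\<^sub>R (\<chi> i. if i = 1 then cos t else sin t)"

text \<open>Normal derivative from outside the disk, nu directed into the disk.\<close>
definition outer_normal_deriv :: "(real^2 \<Rightarrow> real) \<Rightarrow> real^2 \<Rightarrow> real \<Rightarrow> real^2 \<Rightarrow> real \<Rightarrow> bool" where
  "outer_normal_deriv u c r y L \<longleftrightarrow>
     ((\<lambda>t. grad u (y + t *\<^sub>R ((1 / r) *\<^sub>R (y - c))) \<bullet> (- ((1 / r) *\<^sub>R (y - c)))) \<longlongrightarrow> L)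
       (at_right 0)"

definition zero_flux :: "(real^2 \<Rightarrow> real) \<Rightarrow> real^2 \<Rightarrow> real \<Rightarrow> bool" where
  "zero_flux u c r \<longleftrightarrow>
     (\<exists>g. (\<forall>t. outer_normal_deriv u c r (circ c r t) (g t))
          \<and> ((\<lambda>t. g t * r) has_integral 0) {0..2 * pi})"

end

theory Submission
  imports Defs "HOL-Complex_Analysis.Complex_Analysis"
begin

text \<open>Let \<open>\<lambda>\<^sub>1, \<lambda>\<^sub>2\<close> be the boundary values of \<open>u\<close> and \<open>k\<^sub>1, k\<^sub>2\<close> those of \<open>h\<close>, which is constant on
  each (Apollonius) circle. With \<open>\<alpha> = (\<lambda>\<^sub>2 - \<lambda>\<^sub>1) / (k\<^sub>2 - k\<^sub>1)\<close> the function \<open>v = u - \<alpha> h\<close> takes the same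
  value on both circles; comparing \<open>v\<close> minus this value with multiples of \<open>ln (\<bar>x - c\<^sub>j\<bar> / r\<^sub>j)\<close> shows that it
  is at most of the order of the distance to the boundary, so interior gradient estimates bound
  \<open>\<nabla>v\<close> independently of \<open>\<epsilon>\<close>.

  The Moebius map \<open>z \<mapsto> (z - p\<^sub>1) / (z - p\<^sub>2)\<close> takes the exterior to an annulus, where the method of images
  solves the problem explicitly; vanishing flux singles out this solution, and it yields
  \<open>\<lambda>\<^sub>2 - \<lambda>\<^sub>1 = H(p\<^sub>2) - H(p\<^sub>1)\<close>. With \<open>2\<tau> = \<bar>p\<^sub>2 - p\<^sub>1\<bar>\<close> one then has \<open>\<alpha> - a = O(\<tau>)\<close>
  and \<open>\<nabla>h = O(1 / \<tau>)\<close>, so \<open>\<nabla>b = \<nabla>v + (\<alpha> - a) \<nabla>h\<close> stays bounded.\<close>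

section \<open>Harmonic functions in complex coordinates\<close>

text \<open>The obstacle is the size 1 / \<tau> of \<nabla>h in the gap, where \<tau> is comparable
  to the square root of \<epsilon> for small \<epsilon>: replacing the exact coefficient \<alpha> by
  a is harmless only up to an error O(\<tau>). Now
  \<open>\<alpha> = 2 * pi * \<Delta> / (ln \<rho>2 - ln \<rho>1)\<close> with \<Delta> the
  difference of H between the two fixed points, and numerator and denominator both vanish with
  \<tau>, so each is needed to second order:
  \<open>\<Delta> = 2 * \<tau> * D + O(\<tau>\<^sup>2)\<close>, where D is the derivative of H at p
  along n, and \<open>ln \<rho>2 - ln \<rho>1 = \<tau> * (1 / r1 + 1 / r2) +
  O(\<tau>\<^sup>2)\<close>. The quotient of the leading terms is a, which is the origin of the
  factor r1 r2 / (r1 + r2). A second obstacle is regularity: u is only continuous up to the circles,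
  so its flux cannot be deformed directly. The explicit solution is holomorphic across them; once u
  is identified with it, the flux becomes a residue.\<close>

definition cx :: "real^2 \<Rightarrow> complex" where
  "cx x = Complex (x$1) (x$2)"

definition vc :: "complex \<Rightarrow> real^2" where
  "vc z = (\<chi> i. if i = 1 then Re z else Im z)"

lemma vc_nth [simp]: "vc z $ 1 = Re z" "vc z $ 2 = Im z"
  by (simp_all add: vc_def)

lemma Re_cx [simp]: "Re (cx x) = x$1" and Im_cx [simp]: "Im (cx x) = x$2"
  by (simp_all add: cx_def)

lemma cx_vc [simp]: "cx (vc z) = z"
  by (simp add: complex_eq_iff)

lemma vc_cx [simp]: "vc (cx x) = x"
  by (simp add: vec_eq_iff forall_2)

lemma cx_add: "cx (x + y) = cx x + cx y"
  and cx_diff: "cx (x - y) = cx x - cx y"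
  and cx_minus: "cx (- x) = - cx x"
  and cx_scaleR: "cx (a *\<^sub>R x) = a *\<^sub>R cx x"
  by (simp_all add: complex_eq_iff)

lemma norm_cx [simp]: "norm (cx x) = norm x"
  by (simp add: cmod_def norm_vec_def L2_set_def sum_2)

lemma dist_cx [simp]: "dist (cx x) (cx y) = dist x y"
  by (simp add: dist_norm cx_diff [symmetric])

lemma norm_vc [simp]: "norm (vc z) = norm z"
  by (metis cx_vc norm_cx)

lemma dist_vc [simp]: "dist (vc z) (vc w) = dist z w"
  by (metis cx_vc dist_cx)

lemma bounded_linear_cx: "bounded_linear cx"
  by (rule bounded_linear_intro[where K=1]) (auto simp: cx_add cx_scaleR)

lemma bounded_linear_vc: "bounded_linear vc"
  by (rule bounded_linear_intro[where K=1]) (auto simp: vec_eq_iff forall_2)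

lemma inner_eq_Re_cx: "x \<bullet> y = Re (cnj (cx x) * cx y)"
  by (simp add: inner_vec_def sum_2)

lemma has_derivative_comp_vc:
  assumes "u differentiable at (vc z)"
  shows "((\<lambda>z. u (vc z)) has_derivative
           (\<lambda>h. pd 1 u (vc z) * Re h + pd 2 u (vc z) * Im h)) (at z)"
proof -
  let ?D = "frechet_derivative u (at (vc z))"
  have D: "(u has_derivative ?D) (at (vc z))"
    using assms by (simp add: frechet_derivative_works)
  have lin: "linear ?D"
    using D has_derivative_linear by blast
  have *: "vc h = Re h *\<^sub>R axis 1 1 + Im h *\<^sub>R axis 2 1" for h
    by (simp add: vec_eq_iff forall_2 axis_def)
  have "?D (vc h) = pd 1 u (vc z) * Re h + pd 2 u (vc z) * Im h" for h
    by (simp add: *[of h] linear_add[OF lin] linear_cmul[OF lin] pd_def)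
  moreover have "((\<lambda>z. u (vc z)) has_derivative (\<lambda>h. ?D (vc h))) (at z)"
    by (rule has_derivative_compose[OF bounded_linear_imp_has_derivative[OF bounded_linear_vc]]) (rule D)
  ultimately show ?thesis
    by simp
qed

text \<open>The differential h |-> Re (a * h) is the real inner product with \<open>cnj a\<close>,
  whence the conjugate here and in every later passage between gradients and complex
  derivatives.\<close>

lemma grad_eq_of_has_derivative:
  assumes "((\<lambda>z. u (vc z)) has_derivative (\<lambda>h. Re (a * h))) (at (cx x))"
  shows "cx (grad u x) = cnj a"
proof -
  have "((\<lambda>y. u (vc (cx y))) has_derivative (\<lambda>h. Re (a * cx h))) (at x)"
    by (rule has_derivative_compose[OF bounded_linear_imp_has_derivative[OF bounded_linear_cx]]) (rule assms)
  then have "(u has_derivative (\<lambda>h. Re (a * cx h))) (at x)"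
    by simp
  then have "frechet_derivative u (at x) = (\<lambda>h. Re (a * cx h))"
    by (rule frechet_derivative_at[symmetric])
  then show ?thesis
    by (simp add: grad_def pd_def complex_eq_iff axis_def)
qed

text \<open>Mean value theorem applied twice to the second difference
  \<open>U (z + s + \<i> s) - U (z + s) - U (z + \<i> s) + U z\<close>, in both orders.\<close>

lemma mixed_partials_eq:
  fixes U a b :: "complex \<Rightarrow> real"
  assumes "open S" "z \<in> S"
    and U: "\<And>w. w \<in> S \<Longrightarrow> (U has_derivative (\<lambda>h. a w * Re h + b w * Im h)) (at w)"
    and a: "\<And>w. w \<in> S \<Longrightarrow> (a has_derivative (\<lambda>h. a1 w * Re h + a2 w * Im h)) (at w)"
    and b: "\<And>w. w \<in> S \<Longrightarrow> (b has_derivative (\<lambda>h. b1 w * Re h + b2 w * Im h)) (at w)"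
    and ca: "continuous_on S a2" and cb: "continuous_on S b1"
  shows "a2 z = b1 z"
proof (rule ccontr)
  assume ne: "a2 z \<noteq> b1 z"
  define e where "e = \<bar>a2 z - b1 z\<bar> / 2"
  have "e > 0"
    using ne by (simp add: e_def)
  have ca': "isCont a2 z" and cb': "isCont b1 z"
    using ca cb \<open>open S\<close> \<open>z \<in> S\<close> by (auto simp: continuous_on_eq_continuous_at)
  obtain d1 where d1: "d1 > 0" "\<And>w. dist w z < d1 \<Longrightarrow> dist (a2 w) (a2 z) < e"
    using ca' \<open>e > 0\<close> unfolding continuous_at_eps_delta by (metis dist_commute)
  obtain d2 where d2: "d2 > 0" "\<And>w. dist w z < d2 \<Longrightarrow> dist (b1 w) (b1 z) < e"
    using cb' \<open>e > 0\<close> unfolding continuous_at_eps_delta by (metis dist_commute)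
  obtain d3 where d3: "d3 > 0" "ball z d3 \<subseteq> S"
    using \<open>open S\<close> \<open>z \<in> S\<close> open_contains_ball by blast
  define s where "s = min d1 (min d2 d3) / 3"
  have s: "s > 0" "2 * s < d1" "2 * s < d2" "2 * s < d3"
    using d1(1) d2(1) d3(1) by (auto simp: s_def min_def)
  have near: "dist (z + Complex x y) z \<le> 2 * s" if "0 \<le> x" "x \<le> s" "0 \<le> y" "y \<le> s" for x y
  proof -
    have "cmod (Complex x y) \<le> \<bar>x\<bar> + \<bar>y\<bar>"
      using cmod_le[of "Complex x y"] by simp
    then show ?thesis
      using that by (simp add: dist_norm)
  qed
  have inS: "z + Complex x y \<in> S" if "0 \<le> x" "x \<le> s" "0 \<le> y" "y \<le> s" for x y
    using near[OF that] s(4) d3(2) by (auto simp: dist_commute)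
  have dRe: "((\<lambda>x. W (z + Complex x y)) has_real_derivative p) (at x)"
    if "(W has_derivative (\<lambda>h. p * Re h + q * Im h)) (at (z + Complex x y))" for W p q x y
  proof -
    have "((\<lambda>x. z + Complex x y) has_derivative (\<lambda>h. Complex h 0)) (at x)"
      by (auto intro!: derivative_eq_intros simp: Complex_eq)
    from has_derivative_compose[OF this that] show ?thesis
      by (simp add: has_field_derivative_def mult_commute_abs)
  qed
  have dIm: "((\<lambda>y. W (z + Complex x y)) has_real_derivative q) (at y)"
    if "(W has_derivative (\<lambda>h. p * Re h + q * Im h)) (at (z + Complex x y))" for W p q x y
  proof -
    have "((\<lambda>y. z + Complex x y) has_derivative (\<lambda>h. Complex 0 h)) (at y)"
      by (auto intro!: derivative_eq_intros simp: Complex_eq)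
    from has_derivative_compose[OF this that] show ?thesis
      by (simp add: has_field_derivative_def mult_commute_abs)
  qed
  let ?W = "U (z + Complex s s) - U (z + Complex s 0) - U (z + Complex 0 s) + U (z + Complex 0 0)"
  have "\<exists>x. 0 < x \<and> x < s \<and> (U (z + Complex s s) - U (z + Complex s 0))
        - (U (z + Complex 0 s) - U (z + Complex 0 0)) = (s - 0) * (a (z + Complex x s) - a (z + Complex x 0))"
    by (rule MVT2[OF s(1), where f = "\<lambda>x. U (z + Complex x s) - U (z + Complex x 0)"])
       (use s(1) in \<open>auto intro!: DERIV_diff dRe[OF U] inS\<close>)
  then obtain x where x: "0 < x" "x < s" "?W = s * (a (z + Complex x s) - a (z + Complex x 0))"
    by (auto simp: algebra_simps)
  have "\<exists>y. 0 < y \<and> y < s \<and> a (z + Complex x s) - a (z + Complex x 0) = (s - 0) * a2 (z + Complex x y)"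
    by (rule MVT2[OF s(1), where f = "\<lambda>y. a (z + Complex x y)"])
       (use s(1) x in \<open>auto intro!: dIm[OF a] inS\<close>)
  then obtain y where y: "0 < y" "y < s" "a (z + Complex x s) - a (z + Complex x 0) = s * a2 (z + Complex x y)"
    by auto
  have "\<exists>y. 0 < y \<and> y < s \<and> (U (z + Complex s s) - U (z + Complex 0 s))
        - (U (z + Complex s 0) - U (z + Complex 0 0)) = (s - 0) * (b (z + Complex s y) - b (z + Complex 0 y))"
    by (rule MVT2[OF s(1), where f = "\<lambda>y. U (z + Complex s y) - U (z + Complex 0 y)"])
       (use s(1) in \<open>auto intro!: DERIV_diff dIm[OF U] inS\<close>)
  then obtain y' where y': "0 < y'" "y' < s" "?W = s * (b (z + Complex s y') - b (z + Complex 0 y'))"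
    by (auto simp: algebra_simps)
  have "\<exists>x. 0 < x \<and> x < s \<and> b (z + Complex s y') - b (z + Complex 0 y') = (s - 0) * b1 (z + Complex x y')"
    by (rule MVT2[OF s(1), where f = "\<lambda>x. b (z + Complex x y')"])
       (use s(1) y' in \<open>auto intro!: dRe[OF b] inS\<close>)
  then obtain x' where x': "0 < x'" "x' < s" "b (z + Complex s y') - b (z + Complex 0 y') = s * b1 (z + Complex x' y')"
    by auto
  have "s * (s * a2 (z + Complex x y)) = s * (s * b1 (z + Complex x' y'))"
    using x(3) y(3) y'(3) x'(3) by metis
  then have eq: "a2 (z + Complex x y) = b1 (z + Complex x' y')"
    using s(1) by simp
  have "dist (a2 (z + Complex x y)) (a2 z) < e"
    by (rule d1(2)) (use near[of x y] x y s in auto)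
  moreover have "dist (b1 (z + Complex x' y')) (b1 z) < e"
    by (rule d2(2)) (use near[of x' y'] x' y' s in auto)
  ultimately show False
    using eq unfolding e_def dist_real_def by (auto simp: abs_if split: if_splits)
qed

text \<open>\<open>f = U\<^sub>x - \<i> U\<^sub>y\<close> is holomorphic; the Cauchy--Riemann equations for \<open>f\<close> are harmonicity
  together with the symmetry of the mixed partials.\<close>

definition harm_deriv :: "(complex \<Rightarrow> real) \<Rightarrow> (complex \<Rightarrow> complex) \<Rightarrow> complex set \<Rightarrow> bool" where
  "harm_deriv U f S \<longleftrightarrow> open S \<and> f holomorphic_on S \<and>
     (\<forall>z\<in>S. (U has_derivative (\<lambda>h. Re (f z * h))) (at z))"

lemma harmonic_on_imp_harm_deriv:
  assumes "harmonic_on u S"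
  obtains f where "harm_deriv (\<lambda>z. u (vc z)) f (vc -` S)"
proof
  let ?S = "vc -` S"
  let ?a = "\<lambda>z. pd 1 u (vc z)" and ?b = "\<lambda>z. pd 2 u (vc z)"
  let ?f = "\<lambda>z. complex_of_real (?a z) - \<i> * complex_of_real (?b z)"
  have S: "open S" and du: "u differentiable_on S"
    and dpd: "\<And>i x. x \<in> S \<Longrightarrow> pd i u differentiable at x"
    and cpd: "\<And>i j. continuous_on S (pd j (pd i u))"
    and lap: "\<And>x. x \<in> S \<Longrightarrow> pd 1 (pd 1 u) x + pd 2 (pd 2 u) x = 0"
    using assms by (auto simp: harmonic_on_def sum_2)
  have cvc: "continuous_on A vc" for A
    by (rule linear_continuous_on[OF bounded_linear_vc])
  have op: "open ?S"
    by (rule open_vimage[OF S cvc])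
  have dU: "((\<lambda>z. u (vc z)) has_derivative (\<lambda>h. ?a z * Re h + ?b z * Im h)) (at z)" if "z \<in> ?S" for z
    using that du S by (intro has_derivative_comp_vc) (auto simp: differentiable_on_eq_differentiable_at)
  have da: "(?a has_derivative (\<lambda>h. pd 1 (pd 1 u) (vc z) * Re h + pd 2 (pd 1 u) (vc z) * Im h)) (at z)"
    if "z \<in> ?S" for z
    using that dpd by (intro has_derivative_comp_vc) auto
  have db: "(?b has_derivative (\<lambda>h. pd 1 (pd 2 u) (vc z) * Re h + pd 2 (pd 2 u) (vc z) * Im h)) (at z)"
    if "z \<in> ?S" for z
    using that dpd by (intro has_derivative_comp_vc) auto
  have cc: "continuous_on ?S (\<lambda>z. pd j (pd i u) (vc z))" for i j
    by (rule continuous_on_compose2[OF cpd[of j i] cvc]) auto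
  have sym: "pd 2 (pd 1 u) (vc z) = pd 1 (pd 2 u) (vc z)" if "z \<in> ?S" for z
    by (rule mixed_partials_eq[OF op that dU da db cc cc])
  have "(?f has_field_derivative Complex (pd 1 (pd 1 u) (vc z)) (- pd 1 (pd 2 u) (vc z))) (at z)"
    if z: "z \<in> ?S" for z
  proof -
    have "(?f has_derivative (\<lambda>h. complex_of_real (pd 1 (pd 1 u) (vc z) * Re h + pd 2 (pd 1 u) (vc z) * Im h)
            - \<i> * complex_of_real (pd 1 (pd 2 u) (vc z) * Re h + pd 2 (pd 2 u) (vc z) * Im h))) (at z)"
      by (intro derivative_intros da db z)
    moreover have "pd 2 (pd 2 u) (vc z) = - pd 1 (pd 1 u) (vc z)"
      using lap[of "vc z"] z by simp
    ultimately show ?thesis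
      unfolding has_field_derivative_def
      by (auto simp: sym[OF z] complex_eq_iff algebra_simps elim!: has_derivative_eq_rhs)
  qed
  then have "?f holomorphic_on ?S"
    using op by (auto simp: holomorphic_on_open)
  moreover have "(\<lambda>h. ?a z * Re h + ?b z * Im h) = (\<lambda>h. Re (?f z * h))" for z
    by (auto simp: algebra_simps)
  ultimately show "harm_deriv (\<lambda>z. u (vc z)) ?f ?S"
    using op dU unfolding harm_deriv_def by auto
qed

lemma harm_deriv_grad:
  assumes "harm_deriv (\<lambda>z. u (vc z)) f S" "cx x \<in> S"
  shows "cx (grad u x) = cnj (f (cx x))"
  using assms unfolding harm_deriv_def by (intro grad_eq_of_has_derivative) auto

lemma harm_deriv_add:
  assumes "harm_deriv U f S" "harm_deriv V g S"
  shows "harm_deriv (\<lambda>z. U z + V z) (\<lambda>z. f z + g z) S"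
proof -
  have "((\<lambda>z. U z + V z) has_derivative (\<lambda>h. Re ((f z + g z) * h))) (at z)" if "z \<in> S" for z
    using has_derivative_add[of U "\<lambda>h. Re (f z * h)" "at z" V "\<lambda>h. Re (g z * h)"] assms that unfolding harm_deriv_def
    by (force simp: algebra_simps)
  then show ?thesis
    using assms by (auto simp: harm_deriv_def intro!: holomorphic_intros)
qed

lemma harm_deriv_cmult:
  assumes "harm_deriv U f S"
  shows "harm_deriv (\<lambda>z. c * U z) (\<lambda>z. of_real c * f z) S"
proof -
  have "((\<lambda>z. c * U z) has_derivative (\<lambda>h. Re ((of_real c * f z) * h))) (at z)" if "z \<in> S" for z
    using has_derivative_mult_right[of U "\<lambda>h. Re (f z * h)" "at z" c] assms that unfolding harm_deriv_def
    by (force simp: algebra_simps)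
  then show ?thesis
    using assms by (auto simp: harm_deriv_def intro!: holomorphic_intros)
qed

lemma harm_deriv_diff:
  assumes "harm_deriv U f S" "harm_deriv V g S"
  shows "harm_deriv (\<lambda>z. U z - V z) (\<lambda>z. f z - g z) S"
proof -
  have "((\<lambda>z. U z - V z) has_derivative (\<lambda>h. Re ((f z - g z) * h))) (at z)" if "z \<in> S" for z
    using has_derivative_diff[of U "\<lambda>h. Re (f z * h)" "at z" V "\<lambda>h. Re (g z * h)"] assms that unfolding harm_deriv_def
    by (force simp: algebra_simps)
  then show ?thesis
    using assms by (auto simp: harm_deriv_def intro!: holomorphic_intros)
qed

lemma harm_deriv_minus:
  assumes "harm_deriv U f S"
  shows "harm_deriv (\<lambda>z. - U z) (\<lambda>z. - f z) S"
  using harm_deriv_cmult[OF assms, of "-1"] by simp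

lemma harm_deriv_const: "open S \<Longrightarrow> harm_deriv (\<lambda>z. c) (\<lambda>z. 0) S"
  by (simp add: harm_deriv_def)

lemma harm_deriv_subset: "harm_deriv U f S \<Longrightarrow> T \<subseteq> S \<Longrightarrow> open T \<Longrightarrow> harm_deriv U f T"
  unfolding harm_deriv_def by (auto intro: holomorphic_on_subset)

lemma harm_deriv_continuous_on: "harm_deriv U f S \<Longrightarrow> continuous_on S U"
  unfolding harm_deriv_def
  by (meson continuous_at_imp_continuous_on has_derivative_continuous)

text \<open>Testing the real differential on 1 and \<i> recovers the complex derivative. This turns
  the identification of a potential with the explicit solution into an identity of
  derivatives.\<close>

lemma harm_deriv_unique:
  assumes "harm_deriv U f S" "harm_deriv V g S" "\<And>z. z \<in> S \<Longrightarrow> U z = V z" "z \<in> S"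
  shows "f z = g z"
proof -
  have 1: "(U has_derivative (\<lambda>h. Re (f z * h))) (at z)" "(V has_derivative (\<lambda>h. Re (g z * h))) (at z)"
    using assms unfolding harm_deriv_def by auto
  have "(U has_derivative (\<lambda>h. Re (g z * h))) (at z)"
    by (rule has_derivative_transform_within_open[OF 1(2) _ assms(4)])
       (use assms in \<open>auto simp: harm_deriv_def\<close>)
  then have "(\<lambda>h. Re (f z * h)) = (\<lambda>h. Re (g z * h))"
    using 1(1) has_derivative_unique by blast
  then have "Re (f z * 1) = Re (g z * 1)" "Re (f z * \<i>) = Re (g z * \<i>)"
    by metis+
  then show ?thesis
    by (simp add: complex_eq_iff)
qed

lemma harm_deriv_Re:
  assumes "open S" "F holomorphic_on S"
  shows "harm_deriv (\<lambda>z. Re (F z)) (deriv F) S"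
proof -
  have "((\<lambda>z. Re (F z)) has_derivative (\<lambda>h. Re (deriv F z * h))) (at z)" if "z \<in> S" for z
  proof -
    have "(F has_derivative (\<lambda>h. deriv F z * h)) (at z)"
      using holomorphic_derivI[OF assms(2,1) that] by (simp add: has_field_derivative_def)
    then show ?thesis
      by (rule has_derivative_Re)
  qed
  then show ?thesis
    using assms by (auto simp: harm_deriv_def intro: holomorphic_deriv)
qed

text \<open>Here working with the pair (U, f) pays off: the complex logarithm has no single-valued
  branch around \<open>p\<close>, but its derivative is holomorphic off \<open>p\<close>.\<close>

lemma harm_deriv_ln_norm:
  assumes "open S" "p \<notin> S"
  shows "harm_deriv (\<lambda>z. ln (norm (z - p))) (\<lambda>z. 1 / (z - p)) S"
  unfolding harm_deriv_def
proof (intro conjI ballI)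
  show "(\<lambda>z. 1 / (z - p)) holomorphic_on S"
    using assms by (auto intro!: holomorphic_intros)
  fix z assume "z \<in> S"
  then have ne: "z - p \<noteq> 0"
    using assms by auto
  have "((\<lambda>z. ln (norm (z - p))) has_derivative (\<lambda>h. (h \<bullet> sgn (z - p)) / norm (z - p))) (at z)"
  proof -
    have "(norm has_derivative (\<lambda>h. h \<bullet> sgn (z - p))) (at (z - p))"
      using ne by (rule has_derivative_norm)
    moreover have "((\<lambda>z. z - p) has_derivative (\<lambda>h. h)) (at z)"
      by (auto intro!: derivative_eq_intros)
    ultimately have "((\<lambda>z. norm (z - p)) has_derivative (\<lambda>h. h \<bullet> sgn (z - p))) (at z)"
      by (rule has_derivative_compose[rotated])
    then show ?thesis
      using ne by (auto intro!: derivative_eq_intros simp: divide_inverse)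
  qed
  moreover have "(h \<bullet> sgn (z - p)) / norm (z - p) = Re (1 / (z - p) * h)" for h
  proof -
    have "1 / (z - p) = cnj (z - p) / (norm (z - p))\<^sup>2"
      by (metis complex_div_cnj mult_1)
    then have "Re (1 / (z - p) * h) = Re (cnj (z - p) * h) / (norm (z - p))\<^sup>2"
      by (metis Re_divide_of_real of_real_power times_divide_eq_left)
    moreover have "h \<bullet> sgn (z - p) = Re (cnj (z - p) * h) / norm (z - p)"
      by (simp add: sgn_div_norm inner_complex_def divide_inverse algebra_simps)
    ultimately show ?thesis
      by (simp add: power2_eq_square)
  qed
  ultimately show "((\<lambda>z. ln (norm (z - p))) has_derivative (\<lambda>h. Re (1 / (z - p) * h))) (at z)"
    by simp
qed (fact assms)

text \<open>Local substitute for a global conjugate: convexity of \<open>B\<close> yields a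
  primitive of \<open>f\<close>, its additive constant is fixed at one point, and
  \<open>U - Re F\<close> has zero derivative.\<close>

lemma harm_deriv_primitive:
  assumes "harm_deriv U f S" "open B" "convex B" "B \<subseteq> S" "B \<noteq> {}"
  obtains F where "F holomorphic_on B" "\<And>z. z \<in> B \<Longrightarrow> U z = Re (F z)"
    "\<And>z. z \<in> B \<Longrightarrow> (F has_field_derivative f z) (at z)"
proof -
  have hol: "f holomorphic_on B"
    using assms unfolding harm_deriv_def by (auto intro: holomorphic_on_subset)
  obtain g where g: "\<And>x. x \<in> B \<Longrightarrow> (g has_field_derivative f x) (at x within B)"
    by (rule holomorphic_convex_primitive'[OF assms(3,2) hol]) (rule that)
  have g': "(g has_field_derivative f x) (at x)" if "x \<in> B" for x
    using g[OF that] unfolding at_within_open[OF that assms(2)] .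
  obtain x0 where x0: "x0 \<in> B"
    using assms(5) by blast
  define F where "F = (\<lambda>z. g z + of_real (U x0 - Re (g x0)))"
  have F: "(F has_field_derivative f z) (at z)" if "z \<in> B" for z
    unfolding F_def using g'[OF that] by (auto intro!: derivative_eq_intros)
  have "U z - Re (F z) = U x0 - Re (F x0)" if "z \<in> B" for z
  proof (rule has_derivative_zero_unique_connected[of B])
    fix x assume x: "x \<in> B"
    have 1: "((\<lambda>z. Re (F z)) has_derivative (\<lambda>h. Re (f x * h))) (at x)"
      using F[OF x] unfolding has_field_derivative_def by (rule has_derivative_Re)
    have 2: "(U has_derivative (\<lambda>h. Re (f x * h))) (at x)"
      using assms x by (auto simp: harm_deriv_def)
    show "((\<lambda>z. U z - Re (F z)) has_derivative (\<lambda>x. 0)) (at x)"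
      using has_derivative_diff[OF 2 1] by simp
  qed (use assms that x0 in \<open>auto intro: convex_connected\<close>)
  then have "\<And>z. z \<in> B \<Longrightarrow> U z = Re (F z)"
    by (simp add: F_def)
  moreover have "F holomorphic_on B"
    using F assms(2) holomorphic_on_open by blast
  ultimately show thesis
    using F that by blast
qed

text \<open>With \<open>U = Re F\<close> and \<open>\<bar>U\<bar> \<le> M\<close>, Cauchy's inequality for \<open>exp (F / M)\<close> bounds \<open>F'\<close>,
  since the modulus of this function lies between \<open>1 / e\<close> and \<open>e\<close>.\<close>

lemma harm_deriv_gradient_estimate:
  assumes "harm_deriv U f S" "ball z d \<subseteq> S" "d > 0" "\<And>w. w \<in> ball z d \<Longrightarrow> \<bar>U w\<bar> \<le> M"
  shows "norm (f z) \<le> 2 * exp 2 * M / d"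
proof -
  \<comment> \<open>\<open>M\<close> may be 0, which the quotient \<open>F / M\<close> excludes. The
    bound is proved for every positive \<open>N\<close> above \<open>M\<close>, and \<open>N\<close>
    tends to \<open>M\<close> at the end.\<close>
  have est: "norm (f z) \<le> 2 * exp 2 * N / d" if "N > 0" "N \<ge> M" for N
  proof -
    obtain F where F: "F holomorphic_on ball z d" "\<And>w. w \<in> ball z d \<Longrightarrow> U w = Re (F w)"
      "\<And>w. w \<in> ball z d \<Longrightarrow> (F has_field_derivative f w) (at w)"
      by (rule harm_deriv_primitive[OF assms(1), of "ball z d"]) (use assms in auto)
    define g where "g = (\<lambda>w. exp (F w / of_real N))"
    have gh: "g holomorphic_on ball z d"
      unfolding g_def using F(1) \<open>N > 0\<close> by (auto intro!: holomorphic_intros)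
    have nz: "norm (g w) = exp (U w / N)" if "w \<in> ball z d" for w
      using F(2)[OF that] by (simp add: g_def)
    \<comment> \<open>Half the radius keeps the closed disc inside the ball and costs the factor
      2.\<close>
    have "norm ((deriv ^^ 1) g z) \<le> fact 1 * exp 1 / (d/2)^1"
    proof (rule Cauchy_inequality)
      show "g holomorphic_on ball z (d/2)"
        by (rule holomorphic_on_subset[OF gh]) (use assms in auto)
      show "continuous_on (cball z (d/2)) g"
        by (rule continuous_on_subset[OF holomorphic_on_imp_continuous_on[OF gh]]) (use assms in auto)
      fix x assume "norm (z - x) = d / 2"
      then have x: "x \<in> ball z d"
        using assms by (auto simp: dist_norm)
      then have "U x / N \<le> 1"
        using assms(4)[OF x] that by (simp add: field_simps)
      then show "norm (g x) \<le> exp 1"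
        using nz[OF x] by simp
    qed (use assms in auto)
    moreover have "(g has_field_derivative g z * (f z / of_real N)) (at z)"
      unfolding g_def using F(3)[of z] assms(3) \<open>N > 0\<close>
      by (auto intro!: derivative_eq_intros simp: field_simps)
    ultimately have "norm (g z * (f z / of_real N)) \<le> 2 * exp 1 / d"
      by (simp add: DERIV_imp_deriv mult.commute)
    then have 1: "exp (U z / N) * (norm (f z) / N) \<le> 2 * exp 1 / d"
      using nz[of z] assms(3) \<open>N > 0\<close> by (simp add: norm_mult norm_divide)
    have "- 1 \<le> U z / N"
      using assms(4)[of z] assms(3) that by (simp add: field_simps)
    then have "exp (-1) * (norm (f z) / N) \<le> exp (U z / N) * (norm (f z) / N)"
      using \<open>N > 0\<close> by (intro mult_right_mono) auto
    with 1 have "exp (-1) * (norm (f z) / N) \<le> 2 * exp 1 / d"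
      by linarith
    then have "exp 1 * (exp (-1) * (norm (f z) / N)) \<le> exp 1 * (2 * exp 1 / d)"
      by (rule mult_left_mono) simp
    then have "norm (f z) / N \<le> 2 * (exp 1 * exp 1) / d"
      by (simp add: exp_minus field_simps)
    then show ?thesis
      using \<open>N > 0\<close> by (simp add: field_simps flip: exp_add)
  qed
  have "M \<ge> 0"
    using assms(4)[of z] assms(3) by fastforce
  show ?thesis
  proof (rule field_le_epsilon)
    fix e :: real assume "e > 0"
    define N where "N = M + e * d / (2 * exp 2)"
    have "N > 0" "N \<ge> M"
      using \<open>e > 0\<close> \<open>M \<ge> 0\<close> assms(3) by (auto simp: N_def intro!: add_nonneg_pos divide_pos_pos)
    from est[OF this] show "norm (f z) \<le> 2 * exp 2 * M / d + e"
      using assms(3) by (simp add: N_def ring_distribs add_divide_distrib)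
  qed
qed

text \<open>If some value exceeds \<open>m\<close>, all maximum points lie in \<open>S\<close>. Take
  one of largest norm: the maximum modulus principle for exp F makes \<open>U\<close> constant near
  it, and a small step away from the origin yields a maximum point of larger norm.\<close>

lemma harm_deriv_max_principle:
  assumes "harm_deriv U f S" "compact K" "S \<subseteq> K" "continuous_on K U"
    and bd: "\<And>z. z \<in> K - S \<Longrightarrow> U z \<le> m" and z: "z \<in> K"
  shows "U z \<le> m"
proof (rule ccontr)
  assume "\<not> U z \<le> m"
  obtain x0 where x0: "x0 \<in> K" "\<And>y. y \<in> K \<Longrightarrow> U y \<le> U x0"
    using continuous_attains_sup[OF assms(2) _ assms(4)] z by blast
  define L where "L = {x \<in> K. U x = U x0}"
  have "closed L"
    unfolding L_def using continuous_closed_preimage_constant[OF assms(4), of "U x0"] assms(2)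
    by (auto simp: compact_imp_closed)
  then have "compact L"
    using compact_Int_closed[OF assms(2), of L] by (auto simp: L_def Int_absorb1 Int_def)
  moreover have "L \<noteq> {}"
    using x0 by (auto simp: L_def)
  ultimately obtain x1 where x1: "x1 \<in> L" "\<And>y. y \<in> L \<Longrightarrow> norm y \<le> norm x1"
    using continuous_attains_sup[of L norm] continuous_on_norm_id by blast
  have "U x1 > m"
    using x0(2)[OF z] \<open>\<not> U z \<le> m\<close> x1(1) by (auto simp: L_def)
  then have "x1 \<in> S"
    using bd[of x1] x1(1) by (force simp: L_def)
  moreover have "open S"
    using assms(1) by (simp add: harm_deriv_def)
  ultimately obtain r where r: "r > 0" "ball x1 r \<subseteq> S"
    using open_contains_ball by blast
  obtain F where F: "F holomorphic_on ball x1 r" "\<And>w. w \<in> ball x1 r \<Longrightarrow> U w = Re (F w)"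
    by (rule harm_deriv_primitive[OF assms(1), of "ball x1 r"]) (use r in auto)
  have "(\<lambda>w. exp (F w)) constant_on ball x1 r"
  proof (rule maximum_modulus_principle[where U = "ball x1 r" and \<xi> = x1])
    fix w assume w: "w \<in> ball x1 r"
    then have "U w \<le> U x1"
      using x0(2)[of w] subsetD[OF r(2) w] assms(3) x1(1) by (auto simp: L_def)
    then show "norm (exp (F w)) \<le> norm (exp (F x1))"
      using F(2)[OF w] F(2)[of x1] r(1) by simp
  qed (use F r in \<open>auto intro!: holomorphic_intros\<close>)
  then obtain c where c: "\<And>w. w \<in> ball x1 r \<Longrightarrow> exp (F w) = c"
    by (auto simp: constant_on_def)
  have Uc: "U w = U x1" if "w \<in> ball x1 r" for w
  proof -
    have "norm (exp (F w)) = norm (exp (F x1))"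
      using c[OF that] c[of x1] r(1) by simp
    then show ?thesis
      using F(2)[OF that] F(2)[of x1] r(1) by simp
  qed
  \<comment> \<open>The unit direction away from the origin; at the origin itself any unit vector
    serves.\<close>
  define d where "d = (if x1 = 0 then 1 else sgn x1)"
  define y where "y = x1 + (r/2) *\<^sub>R d"
  have "norm d = 1"
    by (simp add: d_def norm_sgn)
  then have yb: "y \<in> ball x1 r"
    using r(1) by (simp add: y_def dist_norm)
  have "y = (norm x1 + r/2) *\<^sub>R d"
    by (auto simp: y_def d_def sgn_div_norm algebra_simps)
  then have "norm y = norm x1 + r/2"
    using \<open>norm d = 1\<close> r(1) by (metis norm_scaleR mult.right_neutral abs_of_nonneg norm_ge_zero add_nonneg_nonneg less_eq_real_def half_gt_zero)
  moreover have "y \<in> L"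
    using Uc[OF yb] yb r(2) assms(3) x1(1) by (auto simp: L_def)
  ultimately show False
    using x1(2)[of y] r(1) by simp
qed

section \<open>Exterior maximum principle, images and flux\<close>

text \<open>A negative \<open>m\<close> is not excluded, so the limit 0 at infinity does not by
  itself give \<open>U z \<le> m\<close> on large circles. Subtracting \<open>d * l\<close>, with
  \<open>l\<close> a nonnegative logarithm growing at infinity, does so for every d > 0; then d
  tends to 0. The second conclusion, read off at infinity, later pins down boundary
  constants.\<close>

lemma exterior_max_principle:
  fixes c1 c2 :: complex and r1 r2 :: real
  defines "E \<equiv> {z. dist z c1 > r1 \<and> dist z c2 > r2}"
    and "Ec \<equiv> {z. dist z c1 \<ge> r1 \<and> dist z c2 \<ge> r2}"
  assumes r1: "r1 > 0" and U: "harm_deriv U f E" and cont: "continuous_on Ec U"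
    and lim: "(U \<longlongrightarrow> 0) at_infinity"
    and bd: "\<And>z. z \<in> Ec - E \<Longrightarrow> U z \<le> m"
  shows "\<And>z. z \<in> Ec \<Longrightarrow> U z \<le> m" and "0 \<le> m"
proof -
  define l where "l = (\<lambda>y. ln (norm (y - c1)) - ln r1)"
  have lnn: "l y \<ge> 0" if "y \<in> Ec" for y
    using that r1 ln_mono[of r1 "norm (y - c1)"] by (auto simp: Ec_def l_def dist_norm)
  have clEc: "closed Ec"
    unfolding Ec_def by (intro closed_Collect_conj closed_Collect_le continuous_intros)
  have opE: "open E"
    unfolding E_def by (intro open_Collect_conj open_Collect_less continuous_intros)
  have flt: "filterlim (\<lambda>y. l y) at_top at_infinity"
  proof -
    have "filterlim (\<lambda>y. norm (y - c1)) at_top at_infinity"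
    proof (rule filterlim_at_top_mono)
      show "filterlim (\<lambda>y::complex. - norm c1 + norm y) at_top at_infinity"
        by (rule filterlim_tendsto_add_at_top[OF tendsto_const filterlim_norm_at_top])
    qed (use norm_triangle_ineq2 in \<open>auto intro!: always_eventually simp: algebra_simps\<close>)
    then have "filterlim (\<lambda>y. ln (norm (y - c1))) at_top at_infinity"
      by (rule filterlim_compose[OF ln_at_top])
    then have "filterlim (\<lambda>y. - ln r1 + ln (norm (y - c1))) at_top at_infinity"
      by (rule filterlim_tendsto_add_at_top[OF tendsto_const])
    then show ?thesis
      by (simp add: l_def)
  qed
  show main: "U z \<le> m" if z: "z \<in> Ec" for z
  proof -
    have W: "U z - d * l z \<le> m" if "d > 0" for d
    proof -
      have "eventually (\<lambda>y. U y < 1) at_infinity"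
        using lim by (rule order_tendstoD) simp
      moreover have "eventually (\<lambda>y. l y \<ge> (1 - m) / d) at_infinity"
        using flt by (simp add: filterlim_at_top)
      ultimately have "eventually (\<lambda>y. U y - d * l y \<le> m) at_infinity"
      proof eventually_elim
        case (elim y)
        then have "1 - m \<le> d * l y"
          using that by (simp add: field_simps)
        with elim show ?case by linarith
      qed
      then obtain b where b: "\<And>y. norm y \<ge> b \<Longrightarrow> U y - d * l y \<le> m"
        unfolding eventually_at_infinity by blast
      define b' where "b' = max b (norm z + 1)"
      let ?K = "Ec \<inter> cball 0 b'" and ?S = "E \<inter> ball 0 b'"
      have hl: "harm_deriv l (\<lambda>z. 1 / (z - c1)) ?S"
        using harm_deriv_diff[OF harm_deriv_ln_norm[of ?S c1] harm_deriv_const[of ?S "ln r1"]] opE r1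
        unfolding l_def by (simp add: E_def open_Int)
      have hU: "harm_deriv U f ?S"
        by (rule harm_deriv_subset[OF U]) (use opE in auto)
      show ?thesis
      proof (rule harm_deriv_max_principle[OF harm_deriv_diff[OF hU harm_deriv_cmult[OF hl, of d]]])
        show "compact ?K"
          using clEc by (simp add: closed_Int_compact)
        show "?S \<subseteq> ?K"
          by (auto simp: E_def Ec_def)
        show "continuous_on ?K (\<lambda>z. U z - d * l z)"
          unfolding l_def
          by (intro continuous_intros continuous_on_subset[OF cont])
             (use r1 in \<open>auto simp: Ec_def\<close>)
        show "z \<in> ?K"
          using z by (auto simp: b'_def)
        fix y assume y: "y \<in> ?K - ?S"
        show "U y - d * l y \<le> m"
        proof (cases "y \<in> E")
          case True
          then have "norm y = b'"
            using y by auto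
          then show ?thesis
            using b[of y] by (auto simp: b'_def)
        next
          case False
          then have "U y \<le> m" "d * l y \<ge> 0"
            using y bd[of y] lnn[of y] that by auto
          then show ?thesis by linarith
        qed
      qed
    qed
    show ?thesis
    proof (rule field_le_epsilon)
      fix t :: real assume "t > 0"
      define d where "d = t / (l z + 1)"
      have "d > 0" "d * l z \<le> t"
        using \<open>t > 0\<close> lnn[OF z] by (auto simp: d_def field_simps)
      then show "U z \<le> m + t"
        using W[of d] by linarith
    qed
  qed
  have "eventually (\<lambda>y. y \<in> Ec) at_infinity"
    unfolding eventually_at_infinity
  proof (intro exI allI impI)
    fix y :: complex assume y: "norm y \<ge> max (norm c1 + r1) (norm c2 + r2)"
    have "norm y - norm c1 \<le> norm (y - c1)" "norm y - norm c2 \<le> norm (y - c2)"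
      using norm_triangle_ineq2 by blast+
    with y show "y \<in> Ec"
      by (simp add: Ec_def dist_norm)
  qed
  then have "eventually (\<lambda>y. U y \<le> m) at_infinity"
    by (rule eventually_mono) (rule main)
  then show "0 \<le> m"
    by (rule tendsto_upperbound[OF lim]) (rule trivial_limit_at_infinity)
qed

text \<open>Comparing coefficients gives b n * (1 / \<kappa> ^ n - 1) = a n, solvable except at n =
  0, which is why \<open>G 0\<close> is removed. The factor \<kappa> ^ n in the solution enlarges
  the disc of convergence to radius 1 / \<kappa>, and the divisors 1 - \<kappa> ^ n stay above 1 -
  \<kappa>.\<close>

lemma cohomological_equation:
  fixes G :: "complex \<Rightarrow> complex" and \<kappa> :: real
  assumes G: "G holomorphic_on ball 0 1" and \<kappa>: "0 < \<kappa>" "\<kappa> < 1"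
  obtains P where "P holomorphic_on ball 0 (1 / \<kappa>)"
    "\<And>w::complex. norm w < 1 \<Longrightarrow> P (w / \<kappa>) - P w = G w - G 0"
proof -
  define a where "a = (\<lambda>n. (deriv ^^ n) G 0 / fact n)"
  define b where "b = (\<lambda>n. if n = 0 then 0 else a n * of_real (\<kappa> ^ n / (1 - \<kappa> ^ n)))"
  define P where "P = (\<lambda>w. \<Sum>n. b n * w ^ n)"
  have a: "(\<lambda>n. a n * w ^ n) sums G w" if "norm w < 1" for w
    using holomorphic_power_series[OF G, of w] that by (simp add: a_def)
  have bsum: "summable (\<lambda>n. b n * w ^ n)" if w: "norm w < 1 / \<kappa>" for w
  proof -
    have "norm (\<kappa> * w) < 1"
      using w \<kappa> by (simp add: norm_mult field_simps)
    then obtain s where s: "norm (\<kappa> * w) < s" "s < 1"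
      using dense by blast
    then have "s > 0"
      using norm_ge_zero le_less_trans by blast
    then have "summable (\<lambda>n. a n * (of_real s) ^ n)"
      using a[of "of_real s"] s(2) sums_summable by auto
    then have "summable (\<lambda>n. norm (a n * (of_real \<kappa> * w) ^ n))"
      by (rule powser_insidea) (use s \<open>s > 0\<close> in simp)
    then have "summable (\<lambda>n. norm (a n * (of_real \<kappa> * w) ^ n) * (1 / (1 - \<kappa>)))"
      by (rule summable_mult2)
    then show ?thesis
    proof (rule summable_comparison_test'[where N = 0])
      fix n
      show "norm (b n * w ^ n) \<le> norm (a n * (of_real \<kappa> * w) ^ n) * (1 / (1 - \<kappa>))"
      proof (cases "n = 0")
        case False
        then have "\<kappa> ^ n \<le> \<kappa>"
          using \<kappa> power_decreasing[of 1 n \<kappa>] by simp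
        then have "norm (1 / (1 - \<kappa> ^ n)) \<le> 1 / (1 - \<kappa>)"
          using \<kappa> by (simp add: frac_le)
        then have "norm (a n * (of_real \<kappa> * w) ^ n) * norm (1 / (1 - \<kappa> ^ n))
            \<le> norm (a n * (of_real \<kappa> * w) ^ n) * (1 / (1 - \<kappa>))"
          by (rule mult_left_mono) simp
        moreover have "norm (b n * w ^ n) = norm (a n * (of_real \<kappa> * w) ^ n) * norm (1 / (1 - \<kappa> ^ n))"
        proof -
          have "b n * w ^ n = a n * (of_real \<kappa> * w) ^ n * of_real (1 / (1 - \<kappa> ^ n))"
            using False by (simp add: b_def power_mult_distrib)
          then show ?thesis
            by (simp only: norm_mult norm_of_real real_norm_def)
        qed
        ultimately show ?thesis by simp
      qed (use \<kappa> in \<open>simp add: b_def\<close>)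
    qed
  qed
  have hol: "P holomorphic_on ball 0 (1 / \<kappa>)"
    by (rule power_series_holomorphic[where a = b])
       (auto simp: P_def intro!: summable_sums bsum)
  have eq: "P (w / \<kappa>) - P w = G w - G 0" if w: "norm w < 1" for w :: complex
  proof -
    have 1: "norm (w / \<kappa>) < 1 / \<kappa>"
      using w \<kappa> by (simp add: norm_divide divide_strict_right_mono)
    have 2: "norm w < 1 / \<kappa>"
      using w \<kappa> less_trans[of "norm w" 1 "1 / \<kappa>"] by simp
    have "(\<lambda>n. b n * (w / \<kappa>) ^ n - b n * w ^ n) sums (P (w / \<kappa>) - P w)"
      unfolding P_def by (intro sums_diff summable_sums bsum 1 2)
    moreover have "b n * (w / \<kappa>) ^ n - b n * w ^ n = a n * w ^ n - (if n = 0 then G 0 else 0)" for n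
    proof (cases "n = 0")
      case False
      then have "\<kappa> ^ n < 1"
        using \<kappa> by (simp add: power_less_one_iff)
      then have ne: "1 - complex_of_real \<kappa> ^ n \<noteq> 0"
        by (metis eq_iff_diff_eq_0 of_real_1 of_real_eq_iff of_real_power order_less_irrefl)
      have "b n * (w / \<kappa>) ^ n - b n * w ^ n
          = a n * w ^ n * (((1 - complex_of_real \<kappa> ^ n) / (1 - complex_of_real \<kappa> ^ n)))"
        using False \<kappa> by (simp add: b_def power_divide field_simps)
      then show ?thesis
        using False ne by simp
    qed (simp add: b_def a_def)
    ultimately have "(\<lambda>n. a n * w ^ n - (if n = 0 then G 0 else 0)) sums (P (w / \<kappa>) - P w)"
      by simp
    moreover have "(\<lambda>n. a n * w ^ n - (if n = 0 then G 0 else 0)) sums (G w - G 0)"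
      by (intro sums_diff a w) (use sums_single[of 0 "\<lambda>_. G 0"] in simp)
    ultimately show ?thesis
      using sums_unique2 by blast
  qed
  show thesis
    by (rule that[OF hol eq])
qed

text \<open>Method of images: the reflections in the two boundary circles compose to \<open>w \<mapsto> \<kappa> w\<close>
  with \<open>\<kappa> = (\<rho>\<^sub>1 / \<rho>\<^sub>2)\<^sup>2\<close>, and the image series are the solutions of the
  cohomological equation for this dilation.\<close>

lemma annulus_images:
  fixes G1 G2 :: "complex \<Rightarrow> complex" and \<rho>1 \<rho>2 :: real
  assumes \<rho>: "0 < \<rho>1" "\<rho>1 < 1" "1 < \<rho>2"
    and G1: "G1 holomorphic_on ball 0 1" and G2: "G2 holomorphic_on ball 0 1"
  obtains A Q where "open A" "{w. \<rho>1 \<le> norm w \<and> norm w \<le> \<rho>2} \<subseteq> A" "Q holomorphic_on A"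
    "\<And>w. norm w = \<rho>1 \<Longrightarrow> Re (Q w) + Re (G1 w) = Re (G1 0)"
    "\<And>w. norm w = \<rho>2 \<Longrightarrow> Re (Q w) + Re (G2 (1 / w)) = Re (G2 0)"
proof -
  define \<kappa> where "\<kappa> = (\<rho>1 / \<rho>2)\<^sup>2"
  have \<kappa>: "0 < \<kappa>" "\<kappa> < 1"
    using \<rho> by (auto simp: \<kappa>_def power_less_one_iff)
  obtain P1 where P1: "P1 holomorphic_on ball 0 (1 / \<kappa>)"
    "\<And>w::complex. norm w < 1 \<Longrightarrow> P1 (w / \<kappa>) - P1 w = G1 w - G1 0"
    using cohomological_equation[OF G1 \<kappa>] by blast
  obtain P2 where P2: "P2 holomorphic_on ball 0 (1 / \<kappa>)"
    "\<And>w::complex. norm w < 1 \<Longrightarrow> P2 (w / \<kappa>) - P2 w = G2 w - G2 0"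
    using cohomological_equation[OF G2 \<kappa>] by blast
  \<comment> \<open>Reflection in a circle is antiholomorphic; conjugating the value of
    \<open>P\<close> as well makes the image term holomorphic and leaves its real part
    unchanged.\<close>
  define C where "C = (\<lambda>P. cnj \<circ> P \<circ> cnj :: complex \<Rightarrow> complex)"
  have [simp]: "cnj ` ball 0 (1 / \<kappa>) = ball 0 (1 / \<kappa>)"
    by (auto simp: image_iff intro!: bexI[of _ "cnj _"])
  have C: "C P holomorphic_on ball 0 (1 / \<kappa>)" if "P holomorphic_on ball 0 (1 / \<kappa>)" for P
    unfolding C_def by (rule holomorphic_on_compose_cnj_cnj) (use that in auto)
  \<comment> \<open>The four bounds place \<open>1 / w\<close>, \<open>\<rho>2\<^sup>2 / w\<close>,
    \<open>w\<close> and \<open>w / \<rho>1\<^sup>2\<close>, in this order, in the disc of radius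
    \<open>1 / \<kappa>\<close>; these are the arguments occurring in \<open>Q\<close>.\<close>
  define A where "A = {w :: complex. \<kappa> < norm w \<and> \<rho>1\<^sup>2 < norm w \<and> norm w < 1 / \<kappa> \<and> norm w < \<rho>2\<^sup>2}"
  \<comment> \<open>On the inner circle \<open>cnj (\<rho>2\<^sup>2 / w) = w / \<kappa>\<close> and
    \<open>cnj (w / \<rho>1\<^sup>2) = 1 / w\<close>: in the real part the \<open>P2\<close> terms
    cancel and the \<open>P1\<close> terms form the difference known from the cohomological
    equation. On the outer circle the roles are exchanged.\<close>
  define Q where "Q = (\<lambda>w::complex. P1 w - C P1 (\<rho>2\<^sup>2 / w) + P2 (1 / w) - C P2 (w / \<rho>1\<^sup>2))"
  have opA: "open A"
    unfolding A_def by (intro open_Collect_conj open_Collect_less continuous_intros)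
  have ne: "w \<noteq> 0" if "w \<in> A" for w
    using that \<kappa> by (auto simp: A_def)
  have "\<rho>1\<^sup>2 < \<rho>1" "\<rho>2 < \<rho>2\<^sup>2"
    using \<rho> by (simp_all add: power2_eq_square)
  moreover have "\<kappa> < \<rho>1\<^sup>2"
  proof -
    have "\<kappa> = \<rho>1\<^sup>2 / \<rho>2\<^sup>2"
      by (simp add: \<kappa>_def power_divide)
    also have "\<dots> < \<rho>1\<^sup>2 / 1"
      by (rule divide_strict_left_mono) (use \<rho> in auto)
    finally show ?thesis by simp
  qed
  moreover have "\<rho>2\<^sup>2 < 1 / \<kappa>"
  proof -
    have "1 / \<kappa> = \<rho>2\<^sup>2 / \<rho>1\<^sup>2"
      by (simp add: \<kappa>_def power_divide)
    moreover have "\<rho>2\<^sup>2 / 1 < \<rho>2\<^sup>2 / \<rho>1\<^sup>2"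
      by (rule divide_strict_left_mono) (use \<rho> in \<open>auto simp: power_less_one_iff\<close>)
    ultimately show ?thesis by simp
  qed
  ultimately have sub: "{w. \<rho>1 \<le> norm w \<and> norm w \<le> \<rho>2} \<subseteq> A"
    by (auto simp: A_def)
  have n1: "norm (\<rho>2\<^sup>2 / w) < 1 / \<kappa>" if "w \<in> A" for w :: complex
  proof -
    have "\<rho>2\<^sup>2 * \<kappa> = \<rho>1\<^sup>2"
      using \<rho> by (simp add: \<kappa>_def power_divide)
    then show ?thesis
      using that \<kappa> ne[OF that] by (simp add: A_def norm_divide norm_power field_simps)
  qed
  have n2: "norm (w / \<rho>1\<^sup>2) < 1 / \<kappa>" if "w \<in> A" for w :: complex
  proof -
    have "\<rho>1\<^sup>2 / \<kappa> = \<rho>2\<^sup>2"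
      using \<rho> by (simp add: \<kappa>_def power_divide)
    then have "norm w < \<rho>1\<^sup>2 / \<kappa>"
      using that by (simp add: A_def)
    then have "norm w / \<rho>1\<^sup>2 < (\<rho>1\<^sup>2 / \<kappa>) / \<rho>1\<^sup>2"
      by (rule divide_strict_right_mono) (use \<rho> in simp)
    then show ?thesis
      using \<rho> by (simp add: norm_divide norm_power)
  qed
  have n3: "norm (1 / w) < 1 / \<kappa>" if "w \<in> A" for w :: complex
    using that \<kappa> ne[OF that] by (auto simp: A_def norm_divide frac_less2)
  have Q: "Q holomorphic_on A"
    unfolding Q_def
  proof (intro holomorphic_on_diff holomorphic_on_add)
    show "P1 holomorphic_on A"
      by (rule holomorphic_on_subset[OF P1(1)]) (auto simp: A_def)
    have "(C P1 \<circ> (\<lambda>w. \<rho>2\<^sup>2 / w)) holomorphic_on A"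
      by (rule holomorphic_on_compose_gen[OF _ C[OF P1(1)]])
         (use ne n1 in \<open>auto intro!: holomorphic_intros\<close>)
    then show "(\<lambda>w. C P1 (\<rho>2\<^sup>2 / w)) holomorphic_on A" by (simp add: o_def)
    have "(P2 \<circ> (\<lambda>w. 1 / w)) holomorphic_on A"
      by (rule holomorphic_on_compose_gen[OF _ P2(1)])
         (use ne n3 in \<open>auto intro!: holomorphic_intros\<close>)
    then show "(\<lambda>w. P2 (1 / w)) holomorphic_on A" by (simp add: o_def)
    have "(C P2 \<circ> (\<lambda>w. w / \<rho>1\<^sup>2)) holomorphic_on A"
      by (rule holomorphic_on_compose_gen[OF _ C[OF P2(1)]])
         (use ne n2 \<rho> in \<open>auto intro!: holomorphic_intros\<close>)
    then show "(\<lambda>w. C P2 (w / \<rho>1\<^sup>2)) holomorphic_on A" by (simp add: o_def)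
  qed
  have b1: "Re (Q w) + Re (G1 w) = Re (G1 0)" if w: "norm w = \<rho>1" for w
  proof -
    have "w \<noteq> 0"
      using w \<rho> by auto
    have ww: "w * cnj w = \<rho>1\<^sup>2"
      using w by (metis complex_norm_square)
    have "cnj (\<rho>2\<^sup>2 / w) = w / \<kappa>"
      using ww \<open>w \<noteq> 0\<close> \<rho> by (simp add: \<kappa>_def power_divide field_simps)
    moreover have "cnj (w / \<rho>1\<^sup>2) = 1 / w"
      using ww \<open>w \<noteq> 0\<close> \<rho> by (simp add: field_simps)
    ultimately have "Re (Q w) = Re (P1 w - P1 (w / \<kappa>))"
      by (simp add: Q_def C_def)
    moreover have "Re (P1 (w / \<kappa>) - P1 w) = Re (G1 w - G1 0)"
      using P1(2)[of w] w \<rho> by simp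
    ultimately show ?thesis by simp
  qed
  have b2: "Re (Q w) + Re (G2 (1 / w)) = Re (G2 0)" if w: "norm w = \<rho>2" for w
  proof -
    have "w \<noteq> 0"
      using w \<rho> by auto
    have ww: "w * cnj w = \<rho>2\<^sup>2"
      using w by (metis complex_norm_square)
    have "cnj (\<rho>2\<^sup>2 / w) = w"
      using ww \<open>w \<noteq> 0\<close> \<rho> by (simp add: field_simps)
    moreover have "cnj (w / \<rho>1\<^sup>2) = (1 / w) / \<kappa>"
      using ww \<open>w \<noteq> 0\<close> \<rho> by (simp add: \<kappa>_def power_divide field_simps)
    ultimately have "Re (Q w) = Re (P2 (1 / w) - P2 ((1 / w) / \<kappa>))"
      by (simp add: Q_def C_def)
    moreover have "Re (P2 ((1 / w) / \<kappa>) - P2 (1 / w)) = Re (G2 (1 / w) - G2 0)"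
      using P2(2)[of "1 / w"] w \<rho> by (simp add: norm_divide)
    ultimately show ?thesis by simp
  qed
  show thesis
    by (rule that[OF opA sub Q b1 b2])
qed

text \<open>On the circle dz = \<i> r cis t dt, so the imaginary part of \<phi> dz is r Re (\<phi>
  cis t) dt, minus the flux density for the normal directed into the disc. The gradient is known
  only in an outer collar of width \<eta>; continuity of \<phi> turns its one-sided limits into
  values on the circle.\<close>

lemma zero_flux_imp_Im_contour_integral:
  assumes "r > 0" "\<eta> > 0"
    and gr: "\<And>x. r < dist x c \<Longrightarrow> dist x c < r + \<eta> \<Longrightarrow> cx (grad u x) = cnj (\<phi> (cx x))"
    and cont: "\<And>z. dist z (cx c) = r \<Longrightarrow> isCont \<phi> z"
    and flux: "zero_flux u c r"
    and I: "(\<phi> has_contour_integral I) (circlepath (cx c) r)"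
  shows "Im I = 0"
proof -
  obtain g where g: "\<And>t. outer_normal_deriv u c r (circ c r t) (g t)"
    and ig: "((\<lambda>t. g t * r) has_integral 0) {0..2 * pi}"
    using flux unfolding zero_flux_def by auto
  have cxcirc: "cx (circ c r t) = cx c + r * cis t" for t
    by (simp add: circ_def complex_eq_iff)
  have gt: "g t = - Re (\<phi> (cx c + r * cis t) * cis t)" for t
  proof -
    let ?y = "circ c r t"
    define n where "n = (1 / r) *\<^sub>R (?y - c)"
    have n: "cx n = cis t"
      unfolding n_def cx_scaleR cx_diff cxcirc using \<open>r > 0\<close> by (simp add: scaleR_conv_of_real)
    have nn: "norm n = 1"
      using n norm_cx[of n] by simp
    have yc: "?y = c + r *\<^sub>R n"
      using \<open>r > 0\<close> by (simp add: n_def)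
    have ds: "dist (?y + s *\<^sub>R n) c = r + s" if "s > 0" for s
    proof -
      have "?y + s *\<^sub>R n - c = (r + s) *\<^sub>R n"
        unfolding yc scaleR_left_distrib by simp
      then have "dist (?y + s *\<^sub>R n) c = \<bar>r + s\<bar> * norm n"
        by (metis dist_norm norm_scaleR)
      then show ?thesis
        using nn that \<open>r > 0\<close> by simp
    qed
    have "eventually (\<lambda>s. s \<in> {0<..<\<eta>}) (at_right (0::real))"
      using \<open>\<eta> > 0\<close> by (rule eventually_at_right_real)
    then have ev: "eventually (\<lambda>s. grad u (?y + s *\<^sub>R n) \<bullet> (- n)
        = - Re (\<phi> (cx ?y + of_real s * cis t) * cis t)) (at_right 0)"
    proof eventually_elim
      case (elim s)
      have "cx (grad u (?y + s *\<^sub>R n)) = cnj (\<phi> (cx (?y + s *\<^sub>R n)))"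
        using elim ds[of s] by (intro gr) auto
      also have "cx (?y + s *\<^sub>R n) = cx ?y + of_real s * cis t"
        unfolding cx_add cx_scaleR n by (simp add: scaleR_conv_of_real)
      finally show ?case
        by (simp add: inner_eq_Re_cx cx_minus n)
    qed
    have "isCont \<phi> (cx ?y)"
      by (rule cont) (use \<open>r > 0\<close> in \<open>simp add: cxcirc dist_norm norm_mult\<close>)
    moreover have "((\<lambda>s::real. cx ?y + of_real s * cis t) \<longlongrightarrow> cx ?y + of_real 0 * cis t) (at_right 0)"
      by (intro tendsto_intros)
    ultimately have "((\<lambda>s::real. \<phi> (cx ?y + of_real s * cis t)) \<longlongrightarrow> \<phi> (cx ?y)) (at_right 0)"
      by (intro isCont_tendsto_compose[of _ \<phi>]) simp_all
    then have "((\<lambda>s::real. - Re (\<phi> (cx ?y + of_real s * cis t) * cis t)) \<longlongrightarrow> - Re (\<phi> (cx ?y) * cis t)) (at_right 0)"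
      by (intro tendsto_intros)
    then have "((\<lambda>s. grad u (?y + s *\<^sub>R n) \<bullet> (- n)) \<longlongrightarrow> - Re (\<phi> (cx ?y) * cis t)) (at_right 0)"
      using ev by (simp add: tendsto_cong)
    moreover have "((\<lambda>s. grad u (?y + s *\<^sub>R n) \<bullet> (- n)) \<longlongrightarrow> g t) (at_right 0)"
      using g[of t] unfolding outer_normal_deriv_def n_def .
    ultimately show ?thesis
      using tendsto_unique[of "at_right (0::real)"] by (fastforce simp: cxcirc)
  qed
  have "((\<lambda>t. \<phi> (cx c + r * cis t) * r * \<i> * cis t) has_integral I) {0..2*pi}"
    using I has_contour_integral_part_circlepath_iff[of 0 "2*pi" \<phi> I "cx c" r] by (simp add: circlepath_def)
  then have "((\<lambda>t. Im (\<phi> (cx c + r * cis t) * r * \<i> * cis t)) has_integral Im I) {0..2*pi}"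
    using has_integral_linear[OF _ bounded_linear_Im] by (force simp: o_def)
  moreover have "Im (\<phi> (cx c + r * cis t) * r * \<i> * cis t) = - (g t * r)" for t
    by (simp add: gt algebra_simps)
  ultimately have "((\<lambda>t. - (g t * r)) has_integral Im I) {0..2*pi}"
    by simp
  then show ?thesis
    using has_integral_unique[OF has_integral_neg[OF ig]] by simp
qed

section \<open>Equal potentials and the geometry of two discs\<close>

text \<open>On the boundary circles \<open>W\<close> vanishes and the barrier is nonnegative. Points
  with norm \<open>R\<close> are at least r1 + 1 away from \<open>c1\<close>, so there the logarithm
  is at least \<open>ln (1 + 1 / r1)\<close>, and the multiplier lifts it to \<open>M\<close>. This
  multiplier sees neither the second disc nor the width of the gap.\<close>

lemma log_barrier:
  fixes c1 c2 :: complex and r1 r2 :: real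
  defines "E \<equiv> {z. dist z c1 > r1 \<and> dist z c2 > r2}"
    and "Ec \<equiv> {z. dist z c1 \<ge> r1 \<and> dist z c2 \<ge> r2}"
  assumes r1: "r1 > 0" and W: "harm_deriv W g E" and cont: "continuous_on Ec W"
    and W0: "\<And>z. z \<in> Ec - E \<Longrightarrow> W z = 0"
    and WM: "\<And>z. z \<in> Ec \<Longrightarrow> norm z \<le> R \<Longrightarrow> W z \<le> M"
    and R: "norm c1 + r1 + 1 \<le> R" and M: "M \<ge> 0"
    and z: "z \<in> Ec" "norm z \<le> R"
  shows "W z \<le> M / ln (1 + 1 / r1) * (ln (norm (z - c1)) - ln r1)"
proof -
  define k where "k = M / ln (1 + 1 / r1)"
  define l where "l = (\<lambda>y. ln (norm (y - c1)) - ln r1)"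
  have ln1: "ln (1 + 1 / r1) > 0"
    using r1 by (intro ln_gt_zero) simp
  have k0: "k \<ge> 0"
    using ln1 M by (simp add: k_def)
  have clEc: "closed Ec"
    unfolding Ec_def by (intro closed_Collect_conj closed_Collect_le continuous_intros)
  have opE: "open E"
    unfolding E_def by (intro open_Collect_conj open_Collect_less continuous_intros)
  let ?K = "Ec \<inter> cball 0 R" and ?S = "E \<inter> ball 0 R"
  have hl: "harm_deriv l (\<lambda>z. 1 / (z - c1)) ?S"
    using harm_deriv_diff[OF harm_deriv_ln_norm[of ?S c1] harm_deriv_const[of ?S "ln r1"]] opE r1
    unfolding l_def by (simp add: E_def open_Int)
  have hW: "harm_deriv W g ?S"
    by (rule harm_deriv_subset[OF W]) (use opE in auto)
  have "W z - k * l z \<le> 0"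
  proof (rule harm_deriv_max_principle[OF harm_deriv_diff[OF hW harm_deriv_cmult[OF hl, of k]]])
    show "compact ?K"
      using clEc by (simp add: closed_Int_compact)
    show "?S \<subseteq> ?K"
      by (auto simp: E_def Ec_def)
    show "continuous_on ?K (\<lambda>z. W z - k * l z)"
      unfolding l_def
      by (intro continuous_intros continuous_on_subset[OF cont])
         (use r1 in \<open>auto simp: Ec_def\<close>)
    show "z \<in> ?K"
      using z by auto
    fix y assume y: "y \<in> ?K - ?S"
    have ly: "l y \<ge> 0"
      using y r1 ln_mono[of r1 "norm (y - c1)"] by (auto simp: Ec_def l_def dist_norm)
    show "W y - k * l y \<le> 0"
    proof (cases "y \<in> E")
      case True
      then have ny: "norm y = R"
        using y by auto
      have "r1 + 1 \<le> norm (y - c1)"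
        using R ny norm_triangle_ineq2[of y c1] by linarith
      then have "ln (r1 + 1) \<le> ln (norm (y - c1))"
        using r1 by (intro ln_mono) auto
      moreover have "1 + 1 / r1 = (r1 + 1) / r1"
        using r1 by (simp add: field_simps)
      ultimately have "ln (1 + 1 / r1) \<le> l y"
        using r1 by (simp add: l_def ln_div)
      then have "k * ln (1 + 1 / r1) \<le> k * l y"
        using k0 by (rule mult_left_mono)
      moreover have "W y \<le> M"
        using y ny by (intro WM) auto
      ultimately show ?thesis
        using ln1 by (simp add: k_def)
    next
      case False
      then have "W y = 0"
        using y by (intro W0) auto
      then show ?thesis
        using k0 ly by simp
    qed
  qed
  then show ?thesis
    by (simp add: k_def l_def)
qed

text \<open>At distance \<open>d\<close> from the boundary the interior estimate loses a factor 1 /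
  d, while \<open>log_barrier\<close>, applied to the nearer circle, gains a factor \<open>d\<close>
  because \<open>V - lam\<close> vanishes there. The two cancel, whatever the gap.\<close>

lemma equal_potential_gradient_bound:
  fixes c1 c2 :: complex and r1 r2 :: real
  defines "E \<equiv> {z. dist z c1 > r1 \<and> dist z c2 > r2}"
    and "Ec \<equiv> {z. dist z c1 \<ge> r1 \<and> dist z c2 \<ge> r2}"
  assumes r: "r1 > 0" "r2 > 0" and V: "harm_deriv V g E" and cont: "continuous_on Ec V"
    and Vl: "\<And>z. z \<in> Ec - E \<Longrightarrow> V z = lam"
    and Hh: "harm_deriv Hc fH UNIV"
    and lim: "((\<lambda>z. V z - Hc z) \<longlongrightarrow> 0) at_infinity"
    and Hm: "\<And>z. norm z \<le> R + 1 \<Longrightarrow> \<bar>Hc z\<bar> \<le> Hm"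
    and R: "norm c1 + r1 \<le> R" "norm c2 + r2 \<le> R"
    and z: "z \<in> E" "norm z \<le> R"
  shows "norm (g z) \<le> 8 * exp 2 * Hm * (1 + 2 / (r1 * ln (1 + 1 / r1)) + 2 / (r2 * ln (1 + 1 / r2)))"
proof -
  have opE: "open E"
    unfolding E_def by (intro open_Collect_conj open_Collect_less continuous_intros)
  have EEc: "E \<subseteq> Ec"
    by (auto simp: E_def Ec_def)
  have U: "harm_deriv (\<lambda>z. V z - Hc z) (\<lambda>z. g z - fH z) E"
    by (intro harm_deriv_diff V harm_deriv_subset[OF Hh] opE) auto
  have cH: "continuous_on A Hc" for A
    using harm_deriv_continuous_on[OF Hh] continuous_on_subset by blast
  have cU: "continuous_on Ec (\<lambda>z. V z - Hc z)"
    by (intro continuous_intros cont cH)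
  have circ_in: "norm y \<le> R + 1" if "y \<in> Ec - E" for y
  proof -
    have "dist y c1 = r1 \<or> dist y c2 = r2"
      using that by (auto simp: E_def Ec_def)
    moreover have "norm y \<le> norm c1 + dist y c1" "norm y \<le> norm c2 + dist y c2"
      by (metis add.commute dist_norm norm_triangle_sub)+
    ultimately show ?thesis
      using R by auto
  qed
  have up: "V y - Hc y \<le> lam + Hm" and lo: "- (V y - Hc y) \<le> Hm - lam" if "y \<in> Ec - E" for y
    using Hm[OF circ_in[OF that]] Vl[OF that] by auto
  note mp1 = exterior_max_principle[OF r(1) U[unfolded E_def] cU[unfolded Ec_def] lim up[unfolded E_def Ec_def]]
  have lim': "((\<lambda>z. - (V z - Hc z)) \<longlongrightarrow> 0) at_infinity"
    using tendsto_minus[OF lim] by simp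
  note mp2 = exterior_max_principle[OF r(1) harm_deriv_minus[OF U[unfolded E_def]]
      continuous_on_minus[OF cU[unfolded Ec_def]] lim' lo[unfolded E_def Ec_def]]
  \<comment> \<open>Since \<open>V - Hc\<close> tends to 0, the boundary bounds
    \<open>lam + Hm\<close> and \<open>Hm - lam\<close> for it and its negative are both
    nonnegative.\<close>
  have lam: "\<bar>lam\<bar> \<le> Hm"
    using mp1(2) mp2(2) by auto
  have "Hm \<ge> 0"
    using lam by linarith
  \<comment> \<open>The difference \<open>V - Hc\<close> is at most Hm + \<bar>lam\<bar> in modulus,
    hence at most 2 * Hm; \<open>Hc\<close> and \<open>lam\<close> contribute one \<open>Hm\<close>
    each.\<close>
  define M where "M = 4 * Hm"
  have "M \<ge> 0"
    using \<open>Hm \<ge> 0\<close> by (simp add: M_def)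
  define W where "W = (\<lambda>z. V z - lam)"
  have WM: "\<bar>W y\<bar> \<le> M" if "y \<in> Ec" "norm y \<le> R + 1" for y
  proof -
    have "V y - Hc y \<le> lam + Hm" "- (V y - Hc y) \<le> Hm - lam"
      using mp1(1)[of y] mp2(1)[of y] that by (auto simp: Ec_def)
    then show ?thesis
      using lam Hm[OF that(2)] by (auto simp: W_def M_def)
  qed
  have W: "harm_deriv W g E"
    using harm_deriv_diff[OF V harm_deriv_const[OF opE, of lam]] by (simp add: W_def)
  have cW: "continuous_on Ec W"
    unfolding W_def by (intro continuous_intros cont)
  have W0: "W y = 0" if "y \<in> Ec - E" for y
    using Vl[OF that] by (simp add: W_def)
  have sw: "{z. dist z c1 > r1 \<and> dist z c2 > r2} = {z. dist z c2 > r2 \<and> dist z c1 > r1}"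
    "{z. dist z c1 \<ge> r1 \<and> dist z c2 \<ge> r2} = {z. dist z c2 \<ge> r2 \<and> dist z c1 \<ge> r1}"
    by auto
  have b1: "\<bar>W y\<bar> \<le> M / ln (1 + 1 / r1) * (ln (norm (y - c1)) - ln r1)"
    if "y \<in> Ec" "norm y \<le> R + 1" for y
  proof -
    have "W y \<le> M / ln (1 + 1 / r1) * (ln (norm (y - c1)) - ln r1)"
      by (rule log_barrier[where W = W and g = g and R = "R + 1" and ?r2.0 = r2 and ?c2.0 = c2])
         (use r W cW W0 WM R that \<open>M \<ge> 0\<close> in \<open>force simp: E_def Ec_def\<close>)+
    moreover have "- W y \<le> M / ln (1 + 1 / r1) * (ln (norm (y - c1)) - ln r1)"
      by (rule log_barrier[where W = "\<lambda>y. - W y" and g = "\<lambda>z. - g z" and R = "R + 1" and ?r2.0 = r2 and ?c2.0 = c2])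
         (use r harm_deriv_minus[OF W] continuous_on_minus[OF cW] W0 WM R that \<open>M \<ge> 0\<close> in \<open>force simp: E_def Ec_def\<close>)+
    ultimately show ?thesis
      by linarith
  qed
  have b2: "\<bar>W y\<bar> \<le> M / ln (1 + 1 / r2) * (ln (norm (y - c2)) - ln r2)"
    if "y \<in> Ec" "norm y \<le> R + 1" for y
  proof -
    have "W y \<le> M / ln (1 + 1 / r2) * (ln (norm (y - c2)) - ln r2)"
      by (rule log_barrier[where W = W and g = g and R = "R + 1" and ?r2.0 = r1 and ?c2.0 = c1])
         (use r W cW W0 WM R that \<open>M \<ge> 0\<close> in \<open>force simp: E_def Ec_def sw\<close>)+
    moreover have "- W y \<le> M / ln (1 + 1 / r2) * (ln (norm (y - c2)) - ln r2)"
      by (rule log_barrier[where W = "\<lambda>y. - W y" and g = "\<lambda>z. - g z" and R = "R + 1" and ?r2.0 = r1 and ?c2.0 = c1])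
         (use r harm_deriv_minus[OF W] continuous_on_minus[OF cW] W0 WM R that \<open>M \<ge> 0\<close> in \<open>force simp: E_def Ec_def sw\<close>)+
    ultimately show ?thesis
      by linarith
  qed
  define K1 where "K1 = 2 / (r1 * ln (1 + 1 / r1))"
  define K2 where "K2 = 2 / (r2 * ln (1 + 1 / r2))"
  have K: "K1 \<ge> 0" "K2 \<ge> 0"
    using r by (auto simp: K1_def K2_def)
  \<comment> \<open>The cap 1 keeps the ball in the region \<open>norm y \<le> R + 1\<close> where
    \<open>Hc\<close> is controlled.\<close>
  define d where "d = min 1 (min (dist z c1 - r1) (dist z c2 - r2))"
  have d: "d > 0" "d \<le> 1" "d \<le> dist z c1 - r1" "d \<le> dist z c2 - r2"
    using z by (auto simp: d_def E_def)
  have dcase: "d = 1 \<or> d = dist z c1 - r1 \<or> d = dist z c2 - r2"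
    by (auto simp: d_def min_def)
  have ballE: "ball z d \<subseteq> E"
  proof
    fix y assume y: "y \<in> ball z d"
    have "dist z c1 \<le> dist z y + dist y c1" "dist z c2 \<le> dist z y + dist y c2"
      by (rule dist_triangle)+
    then show "y \<in> E"
      using y d by (auto simp: E_def)
  qed
  have near: "norm y \<le> R + 1" if "y \<in> ball z d" for y
    using that d(2) z(2) norm_triangle_sub[of y z] by (auto simp: dist_norm norm_minus_commute)
  \<comment> \<open>Points of the ball are within r + 2 * d of the centre of the nearest disc, and
    ln (1 + x) \<le> x with x = 2 * d / r.\<close>
  have lnb: "M / ln (1 + 1 / r) * (ln (norm (y - c)) - ln r) \<le> M * (2 / (r * ln (1 + 1 / r))) * d"
    if y: "y \<in> ball z d" and dd: "d = dist z c - r" and "r > 0" and yc: "norm (y - c) > r" for r c y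
  proof -
    have "norm (y - c) \<le> norm (y - z) + norm (z - c)"
      using norm_triangle_ineq[of "y - z" "z - c"] by simp
    then have "norm (y - c) \<le> r + 2 * d"
      using y dd by (auto simp: dist_norm norm_minus_commute)
    then have "norm (y - c) / r \<le> 1 + 2 * d / r"
      using \<open>r > 0\<close> by (simp add: field_simps)
    moreover have "ln (norm (y - c) / r) \<le> norm (y - c) / r - 1"
      using yc \<open>r > 0\<close> by (intro ln_le_minus_one divide_pos_pos) auto
    moreover have "ln (norm (y - c) / r) = ln (norm (y - c)) - ln r"
      using yc \<open>r > 0\<close> by (subst ln_div) auto
    ultimately have "ln (norm (y - c)) - ln r \<le> 2 * d / r"
      by linarith
    moreover have "M / ln (1 + 1 / r) \<ge> 0"
      using \<open>M \<ge> 0\<close> \<open>r > 0\<close> by simp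
    ultimately have "M / ln (1 + 1 / r) * (ln (norm (y - c)) - ln r) \<le> M / ln (1 + 1 / r) * (2 * d / r)"
      by (rule mult_left_mono)
    then show ?thesis
      by (simp add: mult_ac)
  qed
  have Wd: "\<bar>W y\<bar> \<le> M * (1 + K1 + K2) * d" if y: "y \<in> ball z d" for y
  proof -
    have yE: "y \<in> E" "y \<in> Ec"
      using y ballE EEc by auto
    have mono: "M * t * d \<le> M * (1 + K1 + K2) * d" if "t \<le> 1 + K1 + K2" for t
      using that d(1) \<open>M \<ge> 0\<close> by (intro mult_right_mono mult_left_mono) auto
    from dcase show ?thesis
    proof (elim disjE)
      assume "d = 1"
      then show ?thesis
        using WM[OF yE(2) near[OF y]] mono[of 1] K by auto
    next
      assume "d = dist z c1 - r1"
      then show ?thesis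
        using b1[OF yE(2) near[OF y]] lnb[OF y _ r(1), of c1] mono[of K1] K yE(1)
        by (auto simp: K1_def E_def dist_norm)
    next
      assume "d = dist z c2 - r2"
      then show ?thesis
        using b2[OF yE(2) near[OF y]] lnb[OF y _ r(2), of c2] mono[of K2] K yE(1)
        by (auto simp: K2_def E_def dist_norm)
    qed
  qed
  have "norm (g z) \<le> 2 * exp 2 * (M * (1 + K1 + K2) * d) / d"
    by (rule harm_deriv_gradient_estimate[OF W ballE d(1) Wd])
  then show ?thesis
    using d(1) by (simp add: M_def K1_def K2_def)
qed

section \<open>Coaxal coordinates for two disjoint discs\<close>

locale two_discs =
  fixes r1 r2 \<tau> :: real and m e :: complex
  assumes r1: "r1 > 0" and r2: "r2 > 0" and \<tau>: "\<tau> > 0" and e: "norm e = 1"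
begin

text \<open>Coordinates along the line of centres, with origin \<open>m\<close> on the radical axis. The fixed points
  of the composed reflections are the limit points \<open>m \<plusminus> \<tau> e\<close> of the coaxal pencil.\<close>

definition "A1 = sqrt (\<tau>\<^sup>2 + r1\<^sup>2)"
definition "A2 = sqrt (\<tau>\<^sup>2 + r2\<^sup>2)"
definition "c1 = m - of_real A1 * e"
definition "c2 = m + of_real A2 * e"
definition "p1 = m - of_real \<tau> * e"
definition "p2 = m + of_real \<tau> * e"
definition "\<rho>1 = r1 / (A1 + \<tau>)"
definition "\<rho>2 = (A2 + \<tau>) / r2"
definition "E = {z. dist z c1 > r1 \<and> dist z c2 > r2}"
definition "Ec = {z. dist z c1 \<ge> r1 \<and> dist z c2 \<ge> r2}"
definition "hf z = (1 / (2 * pi)) * (ln (norm (z - p1)) - ln (norm (z - p2)))"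
definition "hder z = of_real (1 / (2 * pi)) * (1 / (z - p1) - 1 / (z - p2))"

lemma A1_sq: "A1\<^sup>2 = \<tau>\<^sup>2 + r1\<^sup>2" and A2_sq: "A2\<^sup>2 = \<tau>\<^sup>2 + r2\<^sup>2"
  by (simp_all add: A1_def A2_def)

lemma A_gt: "A1 > \<tau>" "A2 > \<tau>" "A1 > r1" "A2 > r2"
  using r1 r2 \<tau> unfolding A1_def A2_def by (auto intro!: real_less_rsqrt)

lemma A_less: "A1 < r1 + \<tau>" "A2 < r2 + \<tau>"
  using r1 r2 \<tau> unfolding A1_def A2_def
  by (auto intro!: real_less_lsqrt simp: power2_sum)

lemma \<rho>: "0 < \<rho>1" "\<rho>1 < 1" "1 < \<rho>2"
  using r1 r2 \<tau> A_gt by (auto simp: \<rho>1_def \<rho>2_def)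

lemma norm_sq: "(norm (x + of_real t * e))\<^sup>2 = (norm x)\<^sup>2 + 2 * t * (x \<bullet> e) + t\<^sup>2"
proof -
  have "(norm (x + t *\<^sub>R e))\<^sup>2 = (norm x)\<^sup>2 + 2 * (x \<bullet> (t *\<^sub>R e)) + (norm (t *\<^sub>R e))\<^sup>2"
    unfolding power2_norm_eq_inner by (simp add: inner_add_left inner_add_right inner_commute)
  then show ?thesis
    using e by (simp add: power_mult_distrib norm_mult flip: scaleR_conv_of_real)
qed

text \<open>Because \<open>r1\<^sup>2 = (A1 - \<tau>) * (A1 + \<tau>)\<close>, the weight
  \<open>\<rho>1\<^sup>2\<close> equals (A1 - \<tau>) / (A1 + \<tau>), which makes the left side a
  positive multiple of the power of \<open>z\<close> with respect to the first circle. One identity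
  thus serves both \<open>T_circ1\<close> and \<open>T_ge\<close>.\<close>

lemma apollonius1:
  "(norm (z - p1))\<^sup>2 - \<rho>1\<^sup>2 * (norm (z - p2))\<^sup>2 = 2 * \<tau> / (A1 + \<tau>) * ((norm (z - c1))\<^sup>2 - r1\<^sup>2)"
proof -
  define x where "x = z - m"
  have pos: "A1 + \<tau> \<noteq> 0"
    using A_gt \<tau> by auto
  have eqs: "z - p1 = x + of_real \<tau> * e" "z - p2 = x + of_real (-\<tau>) * e" "z - c1 = x + of_real A1 * e"
    by (simp_all add: x_def p1_def p2_def c1_def)
  have r: "r1\<^sup>2 = (A1 - \<tau>) * (A1 + \<tau>)"
    using A1_sq by (simp add: power2_eq_square algebra_simps)
  have "\<rho>1\<^sup>2 = (A1 - \<tau>) / (A1 + \<tau>)"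
    using pos by (simp add: \<rho>1_def power_divide r) (simp add: power2_eq_square)
  then have "(A1 + \<tau>) * ((norm (z - p1))\<^sup>2 - \<rho>1\<^sup>2 * (norm (z - p2))\<^sup>2)
     = (A1 + \<tau>) * (norm (z - p1))\<^sup>2 - (A1 - \<tau>) * (norm (z - p2))\<^sup>2"
    using pos by (simp add: right_diff_distrib)
  also have "\<dots> = 2 * \<tau> * ((norm (z - c1))\<^sup>2 - r1\<^sup>2)"
    unfolding eqs norm_sq r by (simp add: power2_eq_square algebra_simps)
  finally show ?thesis
    using pos by (simp add: field_simps)
qed

lemma apollonius2:
  "(norm (z - p2))\<^sup>2 - (norm (z - p1))\<^sup>2 / \<rho>2\<^sup>2 = 2 * \<tau> / (A2 + \<tau>) * ((norm (z - c2))\<^sup>2 - r2\<^sup>2)"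
proof -
  define x where "x = z - m"
  have pos: "A2 + \<tau> \<noteq> 0"
    using A_gt \<tau> by auto
  have eqs: "z - p1 = x + of_real \<tau> * e" "z - p2 = x + of_real (-\<tau>) * e" "z - c2 = x + of_real (-A2) * e"
    by (simp_all add: x_def p1_def p2_def c2_def)
  have r: "r2\<^sup>2 = (A2 - \<tau>) * (A2 + \<tau>)"
    using A2_sq by (simp add: power2_eq_square algebra_simps)
  have "1 / \<rho>2\<^sup>2 = (A2 - \<tau>) / (A2 + \<tau>)"
    using pos by (simp add: \<rho>2_def power_divide r) (simp add: power2_eq_square)
  then have "(norm (z - p1))\<^sup>2 / \<rho>2\<^sup>2 = (A2 - \<tau>) / (A2 + \<tau>) * (norm (z - p1))\<^sup>2"
    by (metis mult.commute mult_1 times_divide_eq_right)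
  then have "(A2 + \<tau>) * ((norm (z - p2))\<^sup>2 - (norm (z - p1))\<^sup>2 / \<rho>2\<^sup>2)
     = (A2 + \<tau>) * (norm (z - p2))\<^sup>2 - (A2 - \<tau>) * (norm (z - p1))\<^sup>2"
    using pos by (simp add: right_diff_distrib)
  also have "\<dots> = 2 * \<tau> * ((norm (z - c2))\<^sup>2 - r2\<^sup>2)"
    unfolding eqs norm_sq r by (simp add: power2_eq_square algebra_simps)
  finally show ?thesis
    using pos by (simp add: field_simps)
qed

lemma dist_p_c: "dist p1 c1 = A1 - \<tau>" "dist p2 c2 = A2 - \<tau>" "dist c1 c2 = A1 + A2" "dist p2 c1 = A1 + \<tau>"
proof -
  have *: "p1 - c1 = of_real (A1 - \<tau>) * e" "p2 - c2 = of_real (\<tau> - A2) * e"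
     "c1 - c2 = of_real (- (A1 + A2)) * e" "p2 - c1 = of_real (A1 + \<tau>) * e"
    by (simp_all add: p1_def p2_def c1_def c2_def algebra_simps)
  show "dist p1 c1 = A1 - \<tau>" "dist p2 c2 = A2 - \<tau>" "dist c1 c2 = A1 + A2" "dist p2 c1 = A1 + \<tau>"
    unfolding dist_norm * norm_mult norm_of_real e using A_gt \<tau> by auto
qed

lemma p_in_disc: "dist p1 c1 < r1" "dist p2 c2 < r2"
  using dist_p_c A_less by auto

lemma Ec_ne: "z \<in> Ec \<Longrightarrow> z \<noteq> p1" "z \<in> Ec \<Longrightarrow> z \<noteq> p2"
  using p_in_disc by (auto simp: Ec_def)

lemma E_Ec: "E \<subseteq> Ec"
  by (auto simp: E_def Ec_def)

lemma open_E: "open E"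
  unfolding E_def by (intro open_Collect_conj open_Collect_less continuous_intros)

lemma boundary_cases: "z \<in> Ec - E \<Longrightarrow> dist z c1 = r1 \<or> dist z c2 = r2"
  by (auto simp: E_def Ec_def)

text \<open>As a Moebius map it sends infinity to 1, so decay at infinity becomes a condition at an
  interior point of the annulus.\<close>

definition "T z = (z - p1) / (z - p2)"

lemma T_ge: assumes "z \<in> Ec" shows "\<rho>1 \<le> norm (T z)"
proof -
  have "r1\<^sup>2 \<le> (norm (z - c1))\<^sup>2"
    using assms r1 by (auto simp: Ec_def dist_norm intro!: power_mono)
  then have "2 * \<tau> / (A1 + \<tau>) * ((norm (z - c1))\<^sup>2 - r1\<^sup>2) \<ge> 0"
    using \<tau> A_gt by (intro mult_nonneg_nonneg divide_nonneg_nonneg) auto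
  then have "(\<rho>1 * norm (z - p2))\<^sup>2 \<le> (norm (z - p1))\<^sup>2"
    using apollonius1[of z] by (simp add: power_mult_distrib)
  then have "\<rho>1 * norm (z - p2) \<le> norm (z - p1)"
    by (rule power2_le_imp_le) simp
  then show ?thesis
    using Ec_ne(2)[OF assms] by (simp add: T_def norm_divide field_simps)
qed

lemma T_le: assumes "z \<in> Ec" shows "norm (T z) \<le> \<rho>2"
proof -
  have "r2\<^sup>2 \<le> (norm (z - c2))\<^sup>2"
    using assms r2 by (auto simp: Ec_def dist_norm intro!: power_mono)
  then have "2 * \<tau> / (A2 + \<tau>) * ((norm (z - c2))\<^sup>2 - r2\<^sup>2) \<ge> 0"
    using \<tau> A_gt by (intro mult_nonneg_nonneg divide_nonneg_nonneg) auto
  then have "(norm (z - p1) / \<rho>2)\<^sup>2 \<le> (norm (z - p2))\<^sup>2"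
    using apollonius2[of z] by (simp add: power_divide)
  then have "norm (z - p1) / \<rho>2 \<le> norm (z - p2)"
    by (rule power2_le_imp_le) simp
  then show ?thesis
    using Ec_ne(2)[OF assms] \<rho> by (simp add: T_def norm_divide field_simps)
qed

lemma T_circ1: assumes "dist z c1 = r1" shows "norm (T z) = \<rho>1"
proof -
  have "z \<noteq> p2"
    using assms dist_p_c A_gt \<tau> by auto
  have "(\<rho>1 * norm (z - p2))\<^sup>2 = (norm (z - p1))\<^sup>2"
    using apollonius1[of z] assms by (simp add: power_mult_distrib dist_norm)
  then have "\<rho>1 * norm (z - p2) = norm (z - p1)"
    by (rule power2_eq_imp_eq) (use \<rho> in auto)
  then show ?thesis
    using \<open>z \<noteq> p2\<close> by (simp add: T_def norm_divide field_simps)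
qed

lemma T_circ2: assumes "dist z c2 = r2" shows "norm (T z) = \<rho>2"
proof -
  have "z \<noteq> p2"
    using assms p_in_disc by auto
  have "(norm (z - p1) / \<rho>2)\<^sup>2 = (norm (z - p2))\<^sup>2"
    using apollonius2[of z] assms by (simp add: power_divide dist_norm)
  then have "norm (z - p1) / \<rho>2 = norm (z - p2)"
    by (rule power2_eq_imp_eq) (use \<rho> in auto)
  then show ?thesis
    using \<open>z \<noteq> p2\<close> \<rho> by (simp add: T_def norm_divide field_simps)
qed

lemma hf_eq: "z \<noteq> p1 \<Longrightarrow> z \<noteq> p2 \<Longrightarrow> hf z = ln (norm (T z)) / (2 * pi)"
  by (simp add: hf_def T_def norm_divide ln_div)

lemma T_lim: "(T \<longlongrightarrow> 1) at_infinity"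
proof -
  have "filterlim (\<lambda>z. - p2 + z) at_infinity at_infinity"
    by (rule tendsto_add_filterlim_at_infinity[OF tendsto_const filterlim_ident])
  then have "((\<lambda>z. (p2 - p1) / (- p2 + z)) \<longlongrightarrow> 0) at_infinity"
    by (rule tendsto_divide_0[OF tendsto_const])
  then have "((\<lambda>z. 1 + (p2 - p1) / (- p2 + z)) \<longlongrightarrow> 1 + 0) at_infinity"
    by (intro tendsto_intros)
  moreover have "eventually (\<lambda>z. 1 + (p2 - p1) / (- p2 + z) = T z) at_infinity"
    unfolding eventually_at_infinity
  proof (intro exI allI impI)
    fix z :: complex assume "norm z \<ge> norm p2 + 1"
    then have "z - p2 \<noteq> 0"
      by auto
    then show "1 + (p2 - p1) / (- p2 + z) = T z"
      by (simp add: T_def field_simps)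
  qed
  ultimately show ?thesis
    by (simp add: tendsto_cong)
qed

lemma eventually_Ec: "eventually (\<lambda>z. z \<in> Ec) at_infinity"
  unfolding eventually_at_infinity
proof (intro exI allI impI)
  fix y :: complex assume y: "norm y \<ge> max (norm c1 + r1) (norm c2 + r2)"
  have "norm y - norm c1 \<le> norm (y - c1)" "norm y - norm c2 \<le> norm (y - c2)"
    using norm_triangle_ineq2 by blast+
  with y show "y \<in> Ec"
    by (simp add: Ec_def dist_norm)
qed

lemma hf_lim: "(hf \<longlongrightarrow> 0) at_infinity"
proof -
  have "((\<lambda>z. ln (norm (T z)) / (2 * pi)) \<longlongrightarrow> ln (norm (1::complex)) / (2 * pi)) at_infinity"
    by (intro tendsto_intros T_lim) auto
  moreover have "eventually (\<lambda>z. ln (norm (T z)) / (2 * pi) = hf z) at_infinity"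
    using eventually_Ec by eventually_elim (simp add: hf_eq Ec_ne)
  ultimately show ?thesis
    by (simp add: tendsto_cong)
qed

lemma harm_deriv_hf: "harm_deriv hf hder E"
  unfolding hf_def hder_def
  by (intro harm_deriv_cmult harm_deriv_diff harm_deriv_ln_norm open_E)
     (use E_Ec Ec_ne in auto)

lemma continuous_hf: "continuous_on Ec hf"
  unfolding hf_def by (intro continuous_intros) (use Ec_ne in auto)

lemma hf_circ: "dist z c1 = r1 \<Longrightarrow> hf z = ln \<rho>1 / (2 * pi)" "dist z c2 = r2 \<Longrightarrow> hf z = ln \<rho>2 / (2 * pi)"
proof -
  assume "dist z c1 = r1"
  moreover from this have "z \<noteq> p1" "z \<noteq> p2"
    using p_in_disc dist_p_c A_gt \<tau> by auto
  ultimately show "hf z = ln \<rho>1 / (2 * pi)"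
    by (simp add: hf_eq T_circ1)
next
  assume z: "dist z c2 = r2"
  moreover from z have "z \<noteq> p2"
    using p_in_disc by auto
  moreover have "z \<noteq> p1"
    using T_circ2[OF z] \<rho> by (auto simp: T_def)
  ultimately show "hf z = ln \<rho>2 / (2 * pi)"
    by (simp add: hf_eq T_circ2)
qed

lemma ln_\<rho>: "ln \<rho>1 < 0" "0 < ln \<rho>2"
  using \<rho> by auto

end

section \<open>Explicit exterior solution, potential difference and the size of \<nabla>h\<close>

context two_discs
begin

text \<open>\<open>G1\<close> and \<open>G2\<close> are \<open>G\<close> in the coordinates w and 1
  / w centred at \<open>p1\<close> and \<open>p2\<close>; the inverse of \<open>T\<close> has its
  pole at w = 1, outside the open unit disc. The image term \<open>Q\<close> cancels them on the
  circles up to their central values, and subtracting \<open>Q 1\<close> restores decay. That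
  \<open>F\<close> is single-valued around the discs is what will give it zero flux.\<close>

lemma exterior_image_solution:
  assumes Hh: "harm_deriv Hc fH UNIV"
  obtains N F b where "open N" "Ec \<subseteq> N" "F holomorphic_on N"
    "((\<lambda>z. Re (F z) - Hc z) \<longlongrightarrow> 0) at_infinity"
    "\<And>z. z \<in> Ec \<Longrightarrow> dist z c1 = r1 \<Longrightarrow> Re (F z) = Hc p1 + b"
    "\<And>z. z \<in> Ec \<Longrightarrow> dist z c2 = r2 \<Longrightarrow> Re (F z) = Hc p2 + b"
proof -
  obtain G where G: "G holomorphic_on UNIV" "\<And>z. Hc z = Re (G z)"
    by (rule harm_deriv_primitive[OF Hh, of UNIV]) auto
  define G1 where "G1 = G \<circ> (\<lambda>w. (p1 - w * p2) / (1 - w))"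
  define G2 where "G2 = G \<circ> (\<lambda>w. (p2 - w * p1) / (1 - w))"
  have ne1: "1 - w \<noteq> 0" if "w \<in> ball 0 1" for w :: complex
    using that by auto
  have hol12: "G1 holomorphic_on ball 0 1" "G2 holomorphic_on ball 0 1"
    unfolding G1_def G2_def
    by (rule holomorphic_on_compose_gen[OF _ G(1)]; use ne1 in \<open>force intro!: holomorphic_intros\<close>)+
  obtain A Q where QA: "open A" "{w. \<rho>1 \<le> norm w \<and> norm w \<le> \<rho>2} \<subseteq> A" "Q holomorphic_on A"
    "\<And>w. norm w = \<rho>1 \<Longrightarrow> Re (Q w) + Re (G1 w) = Re (G1 0)"
    "\<And>w. norm w = \<rho>2 \<Longrightarrow> Re (Q w) + Re (G2 (1 / w)) = Re (G2 0)"
    using that by (rule annulus_images[OF \<rho> hol12])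
  define N where "N = {z \<in> - {p2}. T z \<in> A}"
  define F where "F = (\<lambda>z. G z + Q (T z) - Q 1)"
  have Thol: "T holomorphic_on - {p2}"
    unfolding T_def by (auto intro!: holomorphic_intros)
  have opN: "open N"
    using continuous_open_preimage[OF holomorphic_on_imp_continuous_on[OF Thol] _ QA(1)]
    unfolding N_def by (auto simp: vimage_def Int_def)
  have EN: "Ec \<subseteq> N"
    using Ec_ne T_ge T_le QA(2) by (auto simp: N_def)
  have "(Q \<circ> T) holomorphic_on N"
    by (rule holomorphic_on_compose_gen[OF _ QA(3)])
       (auto intro!: holomorphic_on_subset[OF Thol] simp: N_def)
  then have Fhol: "F holomorphic_on N"
    unfolding F_def using holomorphic_on_subset[OF G(1)]
    by (auto intro!: holomorphic_intros simp: o_def)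
  have "1 \<in> A"
    using QA(2) \<rho> by force
  then have "isCont Q 1"
    using QA(1,3) holomorphic_on_imp_continuous_on continuous_on_eq_continuous_at by blast
  then have "((\<lambda>z. Q (T z)) \<longlongrightarrow> Q 1) at_infinity"
    by (rule isCont_tendsto_compose[OF _ T_lim])
  then have "((\<lambda>z. Re (Q (T z) - Q 1)) \<longlongrightarrow> Re (Q 1 - Q 1)) at_infinity"
    by (intro tendsto_intros)
  then have lim: "((\<lambda>z. Re (F z) - Hc z) \<longlongrightarrow> 0) at_infinity"
    by (simp add: F_def G(2))
  have ne0: "p1 - p2 \<noteq> 0"
    using e \<tau> by (auto simp: p1_def p2_def)
  have b1: "Re (F z) = Hc p1 + (- Re (Q 1))" if "z \<in> Ec" "dist z c1 = r1" for z
  proof -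
    have ne: "z - p2 \<noteq> 0"
      using Ec_ne(2)[OF that(1)] by simp
    have "p1 - T z * p2 = z * (1 - T z)" "1 - T z = (p1 - p2) / (z - p2)"
      using ne by (simp_all add: T_def field_simps)
    then have "(p1 - T z * p2) / (1 - T z) = z"
      using ne ne0 by simp
    then have "G1 (T z) = G z"
      by (simp add: G1_def)
    then show ?thesis
      using QA(4)[OF T_circ1[OF that(2)]] by (simp add: F_def G(2) G1_def)
  qed
  have b2: "Re (F z) = Hc p2 + (- Re (Q 1))" if "z \<in> Ec" "dist z c2 = r2" for z
  proof -
    have ne: "z - p2 \<noteq> 0" "z - p1 \<noteq> 0"
      using Ec_ne that(1) by auto
    have "p2 - 1 / T z * p1 = z * (1 - 1 / T z)" "1 - 1 / T z = (p2 - p1) / (z - p1)"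
      using ne by (simp_all add: T_def field_simps)
    then have "(p2 - 1 / T z * p1) / (1 - 1 / T z) = z"
      using ne ne0 by simp
    then have "G2 (1 / T z) = G z"
      by (simp add: G2_def)
    then show ?thesis
      using QA(5)[OF T_circ2[OF that(2)]] by (simp add: F_def G(2) G2_def)
  qed
  show thesis
    by (rule that[OF opN EN Fhol lim b1 b2])
qed

text \<open>Adding \<open>\<beta> * hf\<close> to the explicit solution matches the actual potential
  drop, so \<open>u\<close> minus the sum has one boundary constant and vanishes by the exterior
  maximum principle. The flux of \<open>Re F\<close> is zero and that of \<open>hf\<close> is not,
  which forces \<beta> = 0.\<close>

lemma potential_difference:
  fixes u :: "real^2 \<Rightarrow> real"
  assumes Hh: "harm_deriv Hc fH UNIV"
    and u: "harm_deriv (\<lambda>z. u (vc z)) f E" and cu: "continuous_on Ec (\<lambda>z. u (vc z))"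
    and l1: "\<And>z. dist z c1 = r1 \<Longrightarrow> u (vc z) = lam1"
    and l2: "\<And>z. dist z c2 = r2 \<Longrightarrow> u (vc z) = lam2"
    and lim: "((\<lambda>z. u (vc z) - Hc z) \<longlongrightarrow> 0) at_infinity"
    and flux: "zero_flux u (vc c1) r1"
  shows "lam2 - lam1 = Hc p2 - Hc p1"
proof -
  obtain N F b where F: "open N" "Ec \<subseteq> N" "F holomorphic_on N"
    "((\<lambda>z. Re (F z) - Hc z) \<longlongrightarrow> 0) at_infinity"
    "\<And>z. z \<in> Ec \<Longrightarrow> dist z c1 = r1 \<Longrightarrow> Re (F z) = Hc p1 + b"
    "\<And>z. z \<in> Ec \<Longrightarrow> dist z c2 = r2 \<Longrightarrow> Re (F z) = Hc p2 + b"
    using that by (rule exterior_image_solution[OF Hh])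
  \<comment> \<open>The missing potential drop divided by the drop
    \<open>(ln \<rho>2 - ln \<rho>1) / (2 * pi)\<close> of \<open>hf\<close>.\<close>
  define \<beta> where "\<beta> = 2 * pi * ((lam2 - lam1) - (Hc p2 - Hc p1)) / (ln \<rho>2 - ln \<rho>1)"
  define U where "U = (\<lambda>z. u (vc z) - (Re (F z) + \<beta> * hf z))"
  define \<phi> where "\<phi> = (\<lambda>z. deriv F z + of_real \<beta> * hder z)"
  have \<phi>: "harm_deriv (\<lambda>z. Re (F z) + \<beta> * hf z) \<phi> E"
    unfolding \<phi>_def
    by (intro harm_deriv_add harm_deriv_Re harm_deriv_cmult harm_deriv_hf open_E holomorphic_on_subset[OF F(3)])
       (use E_Ec F(2) in auto)
  have U: "harm_deriv U (\<lambda>z. f z - \<phi> z) E"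
    unfolding U_def by (intro harm_deriv_diff u \<phi>)
  have cF: "continuous_on Ec F"
    using F(2,3) holomorphic_on_imp_continuous_on holomorphic_on_subset by blast
  have cU: "continuous_on Ec U"
    unfolding U_def by (intro continuous_intros cu cF continuous_hf)
  have limU: "(U \<longlongrightarrow> 0) at_infinity"
  proof -
    have "((\<lambda>z. (u (vc z) - Hc z) - (Re (F z) - Hc z) - \<beta> * hf z) \<longlongrightarrow> 0 - 0 - \<beta> * 0) at_infinity"
      by (intro tendsto_intros lim F(4) hf_lim)
    then show ?thesis
      by (simp add: U_def algebra_simps)
  qed
  define k where "k = lam1 - Hc p1 - b - \<beta> * ln \<rho>1 / (2 * pi)"
  have k2: "k = lam2 - Hc p2 - b - \<beta> * ln \<rho>2 / (2 * pi)"
  proof -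
    have "\<beta> * (ln \<rho>2 - ln \<rho>1) / (2 * pi) = (lam2 - lam1) - (Hc p2 - Hc p1)"
      using ln_\<rho> by (simp add: \<beta>_def)
    then show ?thesis
      by (simp add: k_def right_diff_distrib diff_divide_distrib)
  qed
  have Uk: "U z = k" if "z \<in> Ec - E" for z
    using boundary_cases[OF that]
  proof
    assume z: "dist z c1 = r1"
    then show ?thesis
      using that F(5)[of z] l1[OF z] hf_circ(1)[OF z] by (simp add: U_def k_def)
  next
    assume z: "dist z c2 = r2"
    then show ?thesis
      using that F(6)[of z] l2[OF z] hf_circ(2)[OF z] by (simp add: U_def k2)
  qed
  note mp1 = exterior_max_principle[OF r1 U[unfolded E_def] cU[unfolded Ec_def] limU, where m = k]
  have limU': "((\<lambda>z. - U z) \<longlongrightarrow> 0) at_infinity"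
    using tendsto_minus[OF limU] by simp
  note mp2 = exterior_max_principle[OF r1 harm_deriv_minus[OF U[unfolded E_def]]
      continuous_on_minus[OF cU[unfolded Ec_def]] limU', where m = "- k"]
  have Uk': "U z = k" if "z \<in> {z. r1 \<le> dist z c1 \<and> r2 \<le> dist z c2} - {z. r1 < dist z c1 \<and> r2 < dist z c2}" for z
    using Uk that by (auto simp: E_def Ec_def)
  \<comment> \<open>The second conclusion of the exterior principle, for \<open>U\<close> and for
    \<open>- U\<close>, gives 0 \<le> k and 0 \<le> - k.\<close>
  have "k = 0"
    using mp1(2) mp2(2) Uk' by force
  have U0: "U z = 0" if "z \<in> Ec" for z
  proof -
    have "U z \<le> k"
      by (rule mp1(1)) (use Uk' that in \<open>auto simp: Ec_def\<close>)
    moreover have "- U z \<le> - k"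
      by (rule mp2(1)) (use Uk' that in \<open>auto simp: Ec_def\<close>)
    ultimately show ?thesis
      using \<open>k = 0\<close> by simp
  qed
  have f\<phi>: "f z = \<phi> z" if "z \<in> E" for z
    by (rule harm_deriv_unique[OF u \<phi> _ that]) (use U0 E_Ec in \<open>force simp: U_def\<close>)
  have circE: "z \<in> Ec" if "dist z c1 = r1" for z
  proof -
    have "A1 + A2 \<le> r1 + dist z c2"
      using dist_triangle[of c1 c2 z] that dist_p_c(3) by (simp add: dist_commute)
    then show ?thesis
      using that A_gt by (simp add: Ec_def)
  qed
  \<comment> \<open>\<open>deriv F\<close> has the primitive \<open>F\<close> on all of
    \<open>N\<close>; of the two poles of \<open>hder\<close> only \<open>p1\<close> lies inside the
    first circle.\<close>
  have ctr: "(\<phi> has_contour_integral (0 + of_real \<beta> * (of_real (1 / (2 * pi)) * (2 * of_real pi * \<i> * 1 - 0)))) (circlepath c1 r1)"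
    unfolding \<phi>_def hder_def
  proof (intro has_contour_integral_add has_contour_integral_lmul has_contour_integral_diff)
    show "(deriv F has_contour_integral 0) (circlepath c1 r1)"
    proof (rule Cauchy_theorem_primitive[where S = N and f = F])
      show "(F has_field_derivative deriv F x) (at x within N)" if "x \<in> N" for x
        using holomorphic_derivI[OF F(3,1) that] by (rule has_field_derivative_at_within)
      show "path_image (circlepath c1 r1) \<subseteq> N"
        using circE F(2) r1 by (auto simp: dist_commute)
    qed auto
    show "((\<lambda>z. 1 / (z - p1)) has_contour_integral 2 * of_real pi * \<i> * 1) (circlepath c1 r1)"
      by (rule Cauchy_integral_circlepath_simple[where f = "\<lambda>_. 1"])
         (use p_in_disc in \<open>auto simp: dist_norm\<close>)
    show "((\<lambda>z. 1 / (z - p2)) has_contour_integral 0) (circlepath c1 r1)"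
    proof (rule Cauchy_theorem_convex_simple[where S = "cball c1 r1"])
      show "(\<lambda>z. 1 / (z - p2)) holomorphic_on cball c1 r1"
        using dist_p_c(4) A_gt \<tau> by (auto intro!: holomorphic_intros simp: dist_commute)
    qed (use r1 in auto)
  qed
  have "Im (0 + of_real \<beta> * (of_real (1 / (2 * pi)) * (2 * of_real pi * \<i> * 1 - 0))) = 0"
  \<comment> \<open>The width \<eta> is the gap between the discs, so the collar around the first
    one does not meet the second.\<close>
  proof (rule zero_flux_imp_Im_contour_integral[OF r1 _ _ _ flux, where \<eta> = "A1 + A2 - r1 - r2" and \<phi> = \<phi>])
    show "0 < A1 + A2 - r1 - r2"
      using A_gt by simp
    show "cx (grad u x) = cnj (\<phi> (cx x))" if "r1 < dist x (vc c1)" "dist x (vc c1) < r1 + (A1 + A2 - r1 - r2)" for x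
    proof -
      have dx: "dist x (vc c1) = dist (cx x) c1"
        by (metis cx_vc dist_cx)
      have "A1 + A2 \<le> dist (cx x) c1 + dist (cx x) c2"
        using dist_triangle[of c1 c2 "cx x"] dist_p_c(3) by (simp add: dist_commute)
      then have "cx x \<in> E"
        using that dx by (simp add: E_def)
      then show ?thesis
        using harm_deriv_grad[OF u] f\<phi> by simp
    qed
    show "isCont \<phi> z" if "dist z (cx (vc c1)) = r1" for z
    proof -
      have z: "z \<in> Ec"
        using that circE by simp
      have "isCont (deriv F) z"
        using holomorphic_deriv[OF F(3,1)] z F(1,2) 
        by (meson continuous_on_eq_continuous_at holomorphic_on_imp_continuous_on subsetD)
      then show ?thesis
        unfolding \<phi>_def hder_def using Ec_ne[OF z] by (intro continuous_intros) auto
    qed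
    show "(\<phi> has_contour_integral (0 + of_real \<beta> * (of_real (1 / (2 * pi)) * (2 * of_real pi * \<i> * 1 - 0)))) (circlepath (cx (vc c1)) r1)"
      using ctr by simp
  qed
  then have "\<beta> = 0"
    by simp
  then show ?thesis
    using ln_\<rho> by (simp add: \<beta>_def)
qed

text \<open>The two poles combine to (p1 - p2) / ((z - p1) * (z - p2)) with numerator of modulus 2 *
  \<tau>. Both factors below are at least k * \<tau>, and one is at least \<tau> because the poles
  are 2 * \<tau> apart.\<close>

lemma hder_bound:
  assumes "z \<in> E" "A1 + A2 \<le> L"
  shows "norm (hder z) \<le> (L + r1 + r2) / (pi * min r1 r2 * \<tau>)"
proof -
  have ne: "z - p1 \<noteq> 0" "z - p2 \<noteq> 0"
    using Ec_ne E_Ec assms(1) by auto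
  define k where "k = min r1 r2 / (L + r1 + r2)"
  have L: "A1 \<le> L" "A2 \<le> L" "L > 0"
    using assms(2) A_gt \<tau> by auto
  have k: "k > 0" "k \<le> 1"
    using r1 r2 L by (auto simp: k_def min_def)
  \<comment> \<open>The left side is the distance from a limit point to the circle around it; it is
    of order \<tau> by
    \<open>(A + r) * (r + \<tau> - A) = \<tau> * (A + r - \<tau>)\<close>.\<close>
  have gap: "r + \<tau> - A \<ge> k * \<tau>"
    if "r > 0" "r \<ge> min r1 r2" "A\<^sup>2 = \<tau>\<^sup>2 + r\<^sup>2" "A > \<tau>" "A + r \<le> L + r1 + r2" for r A
  proof -
    have "(A + r) * (r + \<tau> - A) = \<tau> * (A + r - \<tau>)"
      using that(3) by (simp add: power2_eq_square algebra_simps)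
    also have "\<dots> \<ge> \<tau> * r"
      using \<tau> that by simp
    finally have "r + \<tau> - A \<ge> \<tau> * r / (A + r)"
      using that \<tau> by (simp add: field_simps)
    moreover have "k \<le> r / (A + r)"
      unfolding k_def using that r1 r2 \<tau> by (intro frac_le) auto
    then have "k * \<tau> \<le> r / (A + r) * \<tau>"
      using \<tau> by (intro mult_right_mono) auto
    ultimately show ?thesis
      by (simp add: mult.commute)
  qed
  have d1: "norm (z - p1) \<ge> k * \<tau>"
  proof -
    have "k * \<tau> \<le> r1 + \<tau> - A1"
      using gap[OF r1 _ A1_sq A_gt(1)] L r2 by simp
    moreover have "dist z c1 \<le> dist z p1 + dist p1 c1"
      by (rule dist_triangle)
    ultimately show ?thesis
      using assms(1) dist_p_c(1) by (auto simp: E_def dist_norm)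
  qed
  have d2: "norm (z - p2) \<ge> k * \<tau>"
  proof -
    have "k * \<tau> \<le> r2 + \<tau> - A2"
      using gap[OF r2 _ A2_sq A_gt(2)] L r1 by simp
    moreover have "dist z c2 \<le> dist z p2 + dist p2 c2"
      by (rule dist_triangle)
    ultimately show ?thesis
      using assms(1) dist_p_c(2) by (auto simp: E_def dist_norm)
  qed
  have p21: "norm (p1 - p2) = 2 * \<tau>"
  proof -
    have "p1 - p2 = of_real (- 2 * \<tau>) * e"
      by (simp add: p1_def p2_def)
    then show ?thesis
      using e \<tau> by (simp add: norm_mult)
  qed
  have "2 * \<tau> \<le> norm (z - p1) + norm (z - p2)"
    using norm_triangle_ineq4[of "z - p2" "z - p1"] p21 by (simp add: add.commute)
  then have prod: "k * \<tau> * \<tau> \<le> norm (z - p1) * norm (z - p2)"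
  proof (cases "norm (z - p1) \<ge> \<tau>")
    case True
    then have "\<tau> * (k * \<tau>) \<le> norm (z - p1) * norm (z - p2)"
      using d2 \<tau> k by (intro mult_mono) auto
    then show ?thesis by (simp add: mult_ac)
  next
    case False
    then have "norm (z - p2) \<ge> \<tau>"
      using \<open>2 * \<tau> \<le> _\<close> by simp
    then show ?thesis
      using d1 \<tau> k by (intro mult_mono) auto
  qed
  have "1 / (z - p1) - 1 / (z - p2) = (p1 - p2) / ((z - p1) * (z - p2))"
    using ne by (simp add: field_simps)
  then have "norm (hder z) = 1 / (2 * pi) * (2 * \<tau> / (norm (z - p1) * norm (z - p2)))"
    unfolding hder_def by (simp add: norm_mult norm_divide p21)
  also have "\<dots> = \<tau> / (pi * (norm (z - p1) * norm (z - p2)))"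
    by simp
  also have "\<dots> \<le> \<tau> / (pi * (k * \<tau> * \<tau>))"
    using prod \<tau> k by (intro divide_left_mono mult_left_mono mult_pos_pos) (use ne in auto)
  also have "\<dots> = (L + r1 + r2) / (pi * min r1 r2 * \<tau>)"
    using \<tau> L r1 r2 by (simp add: k_def)
  finally show ?thesis .
qed

end

section \<open>Asymptotics and fixed points\<close>

text \<open>The logarithm is the inverse hyperbolic sine of \<tau> / r. The first bound comes from
  exp x \<ge> 1 + x + x^2 / 2, the second from ln y \<ge> 1 - 1 / y; together they give the
  second-order accuracy. The third is cruder but stays positive for large \<tau> / r, so it can
  bound a denominator from below.\<close>

lemma ln_half_angle_bounds:
  fixes r \<tau> A :: real
  assumes "r > 0" "\<tau> > 0" "A > 0" "A\<^sup>2 = \<tau>\<^sup>2 + r\<^sup>2"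
  shows "ln ((A + \<tau>) / r) \<le> \<tau> / r" "\<tau> / r - (\<tau> / r)\<^sup>2 / 2 \<le> ln ((A + \<tau>) / r)"
    "\<tau> / (2 * A) \<le> ln ((A + \<tau>) / r)"
proof -
  define y where "y = (A + \<tau>) / r"
  have y: "y > 0"
    using assms by (simp add: y_def)
  have "A\<^sup>2 \<le> (r + \<tau>\<^sup>2 / (2 * r))\<^sup>2"
    using assms by (simp add: power2_sum)
  then have "A \<le> r + \<tau>\<^sup>2 / (2 * r)"
    by (rule power2_le_imp_le) (use assms in simp)
  then have "A / r \<le> (r + \<tau>\<^sup>2 / (2 * r)) / r"
    using assms(1) by (simp add: divide_right_mono)
  also have "\<dots> = 1 + (\<tau> / r)\<^sup>2 / 2"
    using assms(1) by (simp add: add_divide_distrib power_divide power2_eq_square)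
  finally have Ar: "A / r \<le> 1 + (\<tau> / r)\<^sup>2 / 2" .
  have "y \<le> 1 + \<tau> / r + (\<tau> / r)\<^sup>2 / 2"
    using Ar by (simp add: y_def add_divide_distrib)
  also have "\<dots> \<le> exp (\<tau> / r)"
    using exp_lower_Taylor_quadratic[of "\<tau> / r"] assms by simp
  finally have "ln y \<le> ln (exp (\<tau> / r))"
    using y by (intro ln_mono) auto
  then show "ln ((A + \<tau>) / r) \<le> \<tau> / r"
    by (simp add: y_def)
  have lny: "1 - 1 / y \<le> ln y"
    using ln_le_minus_one[of "1 / y"] y by (simp add: ln_div)
  have "r * r = (A + \<tau>) * (A - \<tau>)"
    using assms(4) by (simp add: power2_eq_square algebra_simps)
  then have "1 / y = A / r - \<tau> / r"
    using assms by (simp add: y_def field_simps)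
  then show "\<tau> / r - (\<tau> / r)\<^sup>2 / 2 \<le> ln ((A + \<tau>) / r)"
    using lny Ar by (simp add: y_def)
  have Ag: "A \<ge> r" "A \<ge> \<tau>"
    using assms by (auto intro: power2_le_imp_le)
  have "\<tau> / (2 * A) \<le> \<tau> / (A + \<tau>)"
    using assms Ag by (intro divide_left_mono) auto
  also have "\<dots> \<le> (A + \<tau> - r) / (A + \<tau>)"
    using assms Ag by (intro divide_right_mono) auto
  also have "\<dots> = 1 - 1 / y"
    using assms by (simp add: y_def field_simps)
  finally show "\<tau> / (2 * A) \<le> ln ((A + \<tau>) / r)"
    using lny by (simp add: y_def)
qed

section \<open>Reflections in the circles and their fixed points\<close>

lemma cx_refl_circ: "cx (refl_circ c r x) = cx c + (of_real r)\<^sup>2 / cnj (cx x - cx c)"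
proof -
  define w where "w = cx (x - c)"
  have "(r\<^sup>2 / (norm w)\<^sup>2) *\<^sub>R w = (of_real r)\<^sup>2 / cnj w"
  \<comment> \<open>At the centre both sides are 0 by the convention on division by zero, so the
    formula holds everywhere.\<close>
  proof (cases "w = 0")
    case False
    have "w * cnj w = of_real ((norm w)\<^sup>2)"
      by (metis complex_norm_square)
    then show ?thesis
      using False by (simp add: scaleR_conv_of_real field_simps power2_eq_square)
  qed simp
  moreover have "norm w = norm (x - c)" "w = cx x - cx c"
    unfolding w_def by (rule norm_cx, rule cx_diff)
  ultimately show ?thesis
    unfolding refl_circ_def cx_add cx_scaleR cx_diff by simp
qed

text \<open>The factor depending on \<open>x\<close> and \<open>r\<close> alone is split off so that
  it is the same for both choices of \<open>y\<close>, namely the two limit points, in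
  \<open>fixed_point_unique\<close>.\<close>

lemma norm_inversion_diff:
  fixes x y c :: complex
  assumes "x \<noteq> c" "y \<noteq> c"
  shows "norm ((c + r\<^sup>2 / cnj (x - c)) - (c + r\<^sup>2 / cnj (y - c)))
    = (norm r)\<^sup>2 / norm (x - c) * norm (x - y) / norm (y - c)"
proof -
  have ne: "cnj (x - c) \<noteq> 0" "cnj (y - c) \<noteq> 0"
    using assms by auto
  have "r\<^sup>2 / cnj (x - c) - r\<^sup>2 / cnj (y - c) = r\<^sup>2 * (cnj (y - c) - cnj (x - c)) / (cnj (x - c) * cnj (y - c))"
    using ne by (simp add: field_simps)
  also have "cnj (y - c) - cnj (x - c) = cnj (y - x)"
    by simp
  finally have "norm (r\<^sup>2 / cnj (x - c) - r\<^sup>2 / cnj (y - c))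
      = (norm r)\<^sup>2 * norm (y - x) / (norm (x - c) * norm (y - c))"
    by (simp only: norm_mult norm_divide norm_power complex_mod_cnj)
  then show ?thesis
    by (simp add: norm_minus_commute)
qed

context two_discs
begin

lemma cnj_e: "1 / cnj e = e"
proof -
  have "e * cnj e = 1"
    using e by (simp add: complex_norm_square[symmetric])
  then show ?thesis
    by (metis e eq_divide_eq norm_zero zero_neq_one complex_cnj_zero_iff)
qed

definition "R1 z = c1 + (of_real r1)\<^sup>2 / cnj (z - c1)"
definition "R2 z = c2 + (of_real r2)\<^sup>2 / cnj (z - c2)"

lemma norm_R1_diff:
  assumes "x \<noteq> c1" "y \<noteq> c1"
  shows "norm (R1 x - R1 y) = r1\<^sup>2 / dist x c1 * norm (x - y) / dist y c1"
  unfolding R1_def norm_inversion_diff[OF assms] dist_norm by simp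

lemma norm_R2_diff:
  assumes "x \<noteq> c2" "y \<noteq> c2"
  shows "norm (R2 x - R2 y) = r2\<^sup>2 / dist x c2 * norm (x - y) / dist y c2"
  unfolding R2_def norm_inversion_diff[OF assms] dist_norm by simp

lemma inversion_along_e:
  fixes r s t :: real
  assumes "r\<^sup>2 = s * t" "s \<noteq> 0"
  shows "(of_real r)\<^sup>2 / cnj (of_real s * e) = of_real t * e"
proof -
  have "(of_real r)\<^sup>2 / cnj (of_real s * e) = of_real (r\<^sup>2) / of_real s * (1 / cnj e)"
    by simp
  also have "\<dots> = of_real t * e"
    unfolding cnj_e assms(1) using assms(2) by simp
  finally show ?thesis .
qed

text \<open>Seen from either centre, the limit points lie on one ray at distances A - \<tau> and A +
  \<tau>, whose product is the squared radius: they are inverse in both circles.\<close>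

lemma R_swap: "R1 p1 = p2" "R1 p2 = p1" "R2 p1 = p2" "R2 p2 = p1"
proof -
  have 1: "p1 - c1 = of_real (A1 - \<tau>) * e" "p2 - c1 = of_real (A1 + \<tau>) * e"
     "p1 - c2 = of_real (- (A2 + \<tau>)) * e" "p2 - c2 = of_real (- (A2 - \<tau>)) * e"
    by (simp_all add: p1_def p2_def c1_def c2_def algebra_simps)
  have 2: "r1\<^sup>2 = (A1 - \<tau>) * (A1 + \<tau>)" "r1\<^sup>2 = (A1 + \<tau>) * (A1 - \<tau>)"
     "r2\<^sup>2 = (- (A2 + \<tau>)) * (- (A2 - \<tau>))" "r2\<^sup>2 = (- (A2 - \<tau>)) * (- (A2 + \<tau>))"
    using A1_sq A2_sq by (simp_all add: power2_eq_square algebra_simps)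
  have 3: "A1 - \<tau> \<noteq> 0" "A1 + \<tau> \<noteq> 0" "- (A2 + \<tau>) \<noteq> 0" "- (A2 - \<tau>) \<noteq> 0"
    using A_gt \<tau> by auto
  show "R1 p1 = p2" "R1 p2 = p1" "R2 p1 = p2" "R2 p2 = p1"
    unfolding R1_def R2_def 1
      inversion_along_e[OF 2(1) 3(1)] inversion_along_e[OF 2(2) 3(2)]
      inversion_along_e[OF 2(3) 3(3)] inversion_along_e[OF 2(4) 3(4)]
    by (simp_all add: p1_def p2_def c1_def c2_def algebra_simps)
qed

lemma dist_p1_c2: "dist p1 c2 = A2 + \<tau>"
proof -
  have "p1 - c2 = of_real (- (A2 + \<tau>)) * e"
    by (simp add: p1_def c2_def algebra_simps)
  then show ?thesis
    unfolding dist_norm using A_gt \<tau> e by (simp only: norm_mult norm_of_real) simp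
qed

text \<open>By \<open>R_swap\<close> the composition fixes \<open>p2\<close> as well, so the disc
  condition selects \<open>p1\<close>. It multiplies the distance to \<open>p1\<close> by K1 * K2 /
  ((A1 + \<tau>) * (A2 + \<tau>)) and that to \<open>p2\<close> by K1 * K2 / ((A1 - \<tau>) * (A2 -
  \<tau>)); at any further fixed point both factors would be 1.\<close>

lemma fixed_point_unique:
  assumes z: "dist z c1 < r1" and fp: "R1 (R2 z) = z"
  shows "z = p1"
proof (rule ccontr)
  assume "z \<noteq> p1"
  have zc2: "z \<noteq> c2"
    using z dist_p_c(3) A_gt \<tau> by (auto simp: dist_commute)
  have "z \<noteq> p2"
    using z dist_p_c(4) A_gt \<tau> by auto
  define y where "y = R2 z"
  \<comment> \<open>The distance formula excludes the centre, which \<open>R1\<close> fixes by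
    convention. Then \<open>z = c1\<close> and \<open>R2 c1 = c1\<close>, which would put
    \<open>c1\<close> on the second circle.\<close>
  have yc1: "y \<noteq> c1"
  proof
    assume "y = c1"
    then have "z = c1"
      using fp by (simp add: y_def R1_def)
    then have "(of_real r2)\<^sup>2 / cnj (c1 - c2) = c1 - c2"
      using \<open>y = c1\<close> by (simp add: y_def R2_def algebra_simps)
    then have "norm ((of_real r2)\<^sup>2 / cnj (c1 - c2)) = norm (c1 - c2)"
      by simp
    then have "r2\<^sup>2 / (A1 + A2) = A1 + A2"
      unfolding norm_divide complex_mod_cnj using dist_p_c(3) by (simp add: dist_norm norm_power)
    then have "r2\<^sup>2 = (A1 + A2)\<^sup>2"
      using A_gt \<tau> by (simp add: field_simps power2_eq_square)
    moreover have "r2\<^sup>2 < (A1 + A2)\<^sup>2"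
      using A_gt r1 r2 \<tau> by (intro power_strict_mono) auto
    ultimately show False by simp
  qed
  have pc: "p1 \<noteq> c1" "p2 \<noteq> c1" "p1 \<noteq> c2" "p2 \<noteq> c2"
    using dist_p_c dist_p1_c2 A_gt \<tau> by auto
  define K1 where "K1 = r1\<^sup>2 / dist y c1"
  define K2 where "K2 = r2\<^sup>2 / dist z c2"
  have Y1: "norm (y - p1) = K2 * norm (z - p2) / (A2 - \<tau>)"
    using norm_R2_diff[OF zc2 pc(4)] unfolding R_swap dist_p_c y_def K2_def .
  have Y2: "norm (y - p2) = K2 * norm (z - p1) / (A2 + \<tau>)"
    using norm_R2_diff[OF zc2 pc(3)] unfolding R_swap dist_p1_c2 y_def K2_def .
  have Z1: "norm (z - p1) = K1 * norm (y - p2) / (A1 + \<tau>)"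
    using norm_R1_diff[OF yc1 pc(2)] unfolding R_swap dist_p_c K1_def fp[folded y_def] .
  have Z2: "norm (z - p2) = K1 * norm (y - p1) / (A1 - \<tau>)"
    using norm_R1_diff[OF yc1 pc(1)] unfolding R_swap dist_p_c K1_def fp[folded y_def] .
  have "norm (z - p1) = norm (z - p1) * (K1 * K2 / ((A1 + \<tau>) * (A2 + \<tau>)))"
    using Z1 unfolding Y2 by (simp add: mult_ac)
  then have 1: "K1 * K2 = (A1 + \<tau>) * (A2 + \<tau>)"
    using \<open>z \<noteq> p1\<close> A_gt \<tau> by (simp add: eq_divide_eq)
  have "norm (z - p2) = norm (z - p2) * (K1 * K2 / ((A1 - \<tau>) * (A2 - \<tau>)))"
    using Z2 unfolding Y1 by (simp add: mult_ac)
  then have 2: "K1 * K2 = (A1 - \<tau>) * (A2 - \<tau>)"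
    using \<open>z \<noteq> p2\<close> A_gt \<tau> by (simp add: eq_divide_eq)
  have "(A1 - \<tau>) * (A2 - \<tau>) < (A1 + \<tau>) * (A2 + \<tau>)"
    using A_gt \<tau> by (intro mult_strict_mono) auto
  with 1 2 show False by simp
qed

lemma fixpt1_eq: "fixpt1 (vc c1) r1 (vc c2) r2 = vc p1"
  unfolding fixpt1_def
proof (rule the_equality)
  have cxR: "cx (refl_circ (vc c1) r1 (refl_circ (vc c2) r2 x)) = R1 (R2 (cx x))" for x
    by (simp add: cx_refl_circ R1_def R2_def)
  show "vc p1 \<in> ball (vc c1) r1 \<and> refl_circ (vc c1) r1 (refl_circ (vc c2) r2 (vc p1)) = vc p1"
    using p_in_disc(1) R_swap cxR[of "vc p1"] by (metis cx_vc dist_commute dist_vc mem_ball vc_cx)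
  fix x assume x: "x \<in> ball (vc c1) r1 \<and> refl_circ (vc c1) r1 (refl_circ (vc c2) r2 x) = x"
  have "cx x = p1"
  proof (rule fixed_point_unique)
    show "dist (cx x) c1 < r1"
      using x by (metis cx_vc dist_commute dist_cx mem_ball)
    show "R1 (R2 (cx x)) = cx x"
      using x cxR[of x] by simp
  qed
  then show "x = vc p1"
    by (metis vc_cx)
qed

lemma fixpt2_eq: "fixpt2 (vc c1) r1 (vc c2) r2 = vc p2"
proof -
  \<comment> \<open>Reversing \<open>e\<close> exchanges the discs and the limit points.\<close>
  interpret swap: two_discs r2 r1 \<tau> m "- e"
    by unfold_locales (use r1 r2 \<tau> e in auto)
  have "swap.c1 = c2" "swap.c2 = c1" "swap.p1 = p2"
    by (simp_all add: swap.c1_def swap.c2_def c1_def c2_def swap.A1_def swap.A2_def A1_def A2_def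
        swap.p1_def p2_def)
  then show ?thesis
    using swap.fixpt1_eq by (simp add: fixpt1_def fixpt2_def)
qed

lemma nvec_eq: "cx (nvec (vc p1) (vc p2)) = e"
proof -
  have *: "p2 - p1 = of_real (2 * \<tau>) * e"
    by (simp add: p1_def p2_def)
  then have "norm (p2 - p1) = 2 * \<tau>"
    using e \<tau> by (simp add: norm_mult)
  moreover have "norm (vc p2 - vc p1) = norm (p2 - p1)"
    by (metis dist_norm dist_vc)
  ultimately show ?thesis
    using \<tau> unfolding nvec_def cx_scaleR cx_diff by (simp add: * scaleR_conv_of_real)
qed

text \<open>Measured from \<open>m\<close> along \<open>e\<close>, the facing boundary points sit at
  - (A1 - r1) and A2 - r2; the midpoint differs from \<open>m\<close> unless the radii
  agree.\<close>

lemma midpt_eq: "cx (midpt (vc c1) r1 (vc c2) r2) = m + of_real (((A2 - r2) - (A1 - r1)) / 2) * e"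
proof -
  have *: "c2 - c1 = of_real (A1 + A2) * e"
    by (simp add: c1_def c2_def algebra_simps)
  have n: "norm (vc c2 - vc c1) = A1 + A2"
    using dist_p_c(3) by (metis dist_commute dist_norm dist_vc)
  have ne: "A1 + A2 \<noteq> 0"
    using A_gt \<tau> by auto
  define d where "d = (1 / norm (vc c2 - vc c1)) *\<^sub>R (vc c2 - vc c1)"
  have "cx d = of_real (1 / (A1 + A2)) * (of_real (A1 + A2) * e)"
    unfolding d_def n cx_scaleR cx_diff cx_vc * by (rule scaleR_conv_of_real)
  also have "\<dots> = of_real (1 / (A1 + A2) * (A1 + A2)) * e"
    by (simp only: of_real_mult mult.assoc)
  also have "\<dots> = e"
    using ne by simp
  finally have d: "cx d = e" .
  show ?thesis
    unfolding midpt_def Let_def d_def[symmetric] cx_scaleR cx_add cx_diff cx_vc d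
    by (simp add: c1_def c2_def scaleR_conv_of_real field_simps)
qed

text \<open>Both A1 - r1 and A2 - r2 lie between 0 and \<tau>. Membership allows an expansion of H
  about the midpoint along the segment joining the limit points.\<close>

lemma midpt_in_segment:
  "m + of_real (((A2 - r2) - (A1 - r1)) / 2) * e \<in> closed_segment p1 p2"
proof -
  define s where "s = ((A2 - r2) - (A1 - r1)) / 2"
  have s: "- \<tau> \<le> s" "s \<le> \<tau>"
    using A_gt A_less by (auto simp: s_def)
  define q where "q = (s + \<tau>) / (2 * \<tau>)"
  have q: "0 \<le> q" "q \<le> 1" "s = - \<tau> + q * (2 * \<tau>)"
    using s \<tau> by (auto simp: q_def field_simps)
  have "m + of_real s * e = (1 - q) *\<^sub>R p1 + q *\<^sub>R p2"
    unfolding q(3) by (simp add: p1_def p2_def scaleR_conv_of_real algebra_simps)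
  then show ?thesis
    using q(1,2) unfolding s_def[symmetric] closed_segment_def by blast
qed

text \<open>With k = 1 / r1 + 1 / r2, the denominator \<open_S>\<close>

lemma coefficient_estimate:
  assumes "A1 + A2 \<le> L" "\<bar>\<Delta> - 2 * \<tau> * D\<bar> \<le> B * \<tau>\<^sup>2" "\<bar>D\<bar> \<le> B'" "B \<ge> 0"
  shows "\<bar>2 * pi * \<Delta> / (ln \<rho>2 - ln \<rho>1) - 4 * pi * r1 * r2 / (r1 + r2) * D\<bar>
    \<le> 2 * pi * (B * L + B' * (1 / r1\<^sup>2 + 1 / r2\<^sup>2) * L * (r1 * r2 / (r1 + r2))) * \<tau>"
proof -
  define S where "S = ln \<rho>2 - ln \<rho>1"
  define k where "k = 1 / r1 + 1 / r2"
  define q where "q = (1 / r1\<^sup>2 + 1 / r2\<^sup>2) / 2"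
  have L: "A1 \<le> L" "A2 \<le> L" "A1 > 0" "A2 > 0" "L > 0"
    using assms(1) A_gt \<tau> by auto
  have ln1: "- ln \<rho>1 = ln ((A1 + \<tau>) / r1)"
    using r1 \<tau> L by (simp add: \<rho>1_def ln_div)
  note b1 = ln_half_angle_bounds[OF r1 \<tau> L(3) A1_sq]
  note b2 = ln_half_angle_bounds[OF r2 \<tau> L(4) A2_sq]
  have Seq: "S = ln ((A1 + \<tau>) / r1) + ln ((A2 + \<tau>) / r2)"
    using ln1 by (simp add: S_def \<rho>2_def)
  have "\<tau> / (2 * L) \<le> \<tau> / (2 * A1)" "\<tau> / (2 * L) \<le> \<tau> / (2 * A2)"
    using L \<tau> by (auto intro!: divide_left_mono)
  then have Slow: "\<tau> / L \<le> S"
    using b1(3) b2(3) unfolding Seq by (simp add: field_simps)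
  have S0: "S > 0"
    using Slow \<tau> L divide_pos_pos[of \<tau> L] by linarith
  have k0: "k > 0"
    using r1 r2 by (simp add: k_def add_pos_pos)
  have keq: "1 / k = r1 * r2 / (r1 + r2)"
    using r1 r2 by (simp add: k_def field_simps)
  have Sd: "\<bar>\<tau> * k - S\<bar> \<le> q * \<tau>\<^sup>2"
  proof -
    have "S \<le> \<tau> * k"
      using b1(1) b2(1) unfolding Seq k_def by (simp add: algebra_simps)
    moreover have "\<tau> * k - S \<le> q * \<tau>\<^sup>2"
      using b1(2) b2(2) unfolding Seq k_def q_def
      by (simp add: algebra_simps power_divide add_divide_distrib)
    ultimately show ?thesis
      by simp
  qed
  have "q \<ge> 0" and q2: "2 * (B' * (q * x)) = B' * ((1 / r1\<^sup>2 + 1 / r2\<^sup>2) * x)" for x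
    by (simp_all add: q_def)
  have "\<Delta> / S - 2 * D / k = (\<Delta> - 2 * \<tau> * D) / S + 2 * D * (\<tau> * k - S) / (S * k)"
    using S0 k0 by (simp add: field_simps)
  then have "\<bar>\<Delta> / S - 2 * D / k\<bar> \<le> \<bar>\<Delta> - 2 * \<tau> * D\<bar> / S + 2 * \<bar>D\<bar> * \<bar>\<tau> * k - S\<bar> / (S * k)"
    using S0 k0 abs_triangle_ineq[of "(\<Delta> - 2 * \<tau> * D) / S" "2 * D * (\<tau> * k - S) / (S * k)"]
    by (simp add: abs_mult)
  also have "\<dots> \<le> (B * \<tau>\<^sup>2) / (\<tau> / L) + (2 * B' * (q * \<tau>\<^sup>2)) / (\<tau> / L * k)"
    using assms Sd Slow S0 k0 L \<tau> \<open>q \<ge> 0\<close>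
    by (intro add_mono frac_le mult_mono mult_right_mono mult_nonneg_nonneg) auto
  also have "\<dots> = (B * L + 2 * B' * q * L * (1 / k)) * \<tau>"
    using \<tau> L k0 by (simp add: field_simps power2_eq_square)
  finally have main: "\<bar>\<Delta> / S - 2 * D / k\<bar> \<le> (B * L + 2 * B' * q * L * (1 / k)) * \<tau>" .
  have "2 * pi * \<Delta> / S - 4 * pi * r1 * r2 / (r1 + r2) * D = 2 * pi * (\<Delta> / S - 2 * D * (1 / k))"
    unfolding keq by (simp add: algebra_simps)
  then have "\<bar>2 * pi * \<Delta> / S - 4 * pi * r1 * r2 / (r1 + r2) * D\<bar> = 2 * pi * \<bar>\<Delta> / S - 2 * D / k\<bar>"
    by (simp add: abs_mult)
  also have "\<dots> \<le> 2 * pi * ((B * L + 2 * B' * q * L * (1 / k)) * \<tau>)"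
    by (rule mult_left_mono[OF main]) simp
  finally show ?thesis
    unfolding S_def[symmetric] keq using q2 by (simp only: mult.assoc)
qed

lemma gradient_bound:
  fixes u :: "real^2 \<Rightarrow> real"
  assumes Hh: "harm_deriv Hc fH UNIV"
    and u: "harm_deriv (\<lambda>z. u (vc z)) f E" and cu: "continuous_on Ec (\<lambda>z. u (vc z))"
    and l1: "\<And>z. dist z c1 = r1 \<Longrightarrow> u (vc z) = lam1"
    and l2: "\<And>z. dist z c2 = r2 \<Longrightarrow> u (vc z) = lam2"
    and lim: "((\<lambda>z. u (vc z) - Hc z) \<longlongrightarrow> 0) at_infinity"
    and flux: "zero_flux u (vc c1) r1"
    and R: "norm c1 + r1 \<le> R" "norm c2 + r2 \<le> R"
    and Hm: "\<And>z. norm z \<le> R + 1 \<Longrightarrow> \<bar>Hc z\<bar> \<le> Hm"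
    and H1: "\<And>z. norm z \<le> R \<Longrightarrow> norm (fH z) \<le> B1"
    and H2: "\<And>z w. norm z \<le> R \<Longrightarrow> norm w \<le> R \<Longrightarrow> norm (fH z - fH w) \<le> B2 * norm (z - w)"
    and B2: "B2 \<ge> 0"
    and z: "z \<in> E" "norm z \<le> R"
    and q: "q = m + of_real (((A2 - r2) - (A1 - r1)) / 2) * e"
    and a: "a = 4 * pi * r1 * r2 / (r1 + r2) * Re (e * fH q)"
  shows "norm (f z - of_real a * hder z) \<le>
     8 * exp 2 * Hm * (1 + 2 / (r1 * ln (1 + 1 / r1)) + 2 / (r2 * ln (1 + 1 / r2)))
     + 2 * (4 * B2 * (2 * R) + B1 * (1 / r1\<^sup>2 + 1 / r2\<^sup>2) * (2 * R) * (r1 * r2 / (r1 + r2)))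
         * (2 * R + r1 + r2) / min r1 r2" (is "_ \<le> ?C1 + ?C2")
proof -
  define L where "L = 2 * R"
  define \<Delta> where "\<Delta> = Hc p2 - Hc p1"
  define D where "D = Re (e * fH q)"
  define \<alpha> where "\<alpha> = 2 * pi * \<Delta> / (ln \<rho>2 - ln \<rho>1)"
  have pd: "lam2 - lam1 = \<Delta>"
    unfolding \<Delta>_def by (rule potential_difference[OF Hh u cu l1 l2 lim flux])
  have AL: "A1 + A2 \<le> L"
    using R dist_p_c(3) norm_triangle_ineq4[of c1 c2] r1 r2 by (simp add: L_def dist_norm)
  have V: "harm_deriv (\<lambda>z. u (vc z) - \<alpha> * hf z) (\<lambda>z. f z - of_real \<alpha> * hder z) E"
    by (intro harm_deriv_diff harm_deriv_cmult harm_deriv_hf u)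
  define lam where "lam = lam1 - \<alpha> * ln \<rho>1 / (2 * pi)"
  have lam2: "lam = lam2 - \<alpha> * ln \<rho>2 / (2 * pi)"
  proof -
    have "\<alpha> * (ln \<rho>2 - ln \<rho>1) / (2 * pi) = lam2 - lam1"
      using ln_\<rho> pd by (simp add: \<alpha>_def)
    then show ?thesis
      by (simp add: lam_def right_diff_distrib diff_divide_distrib)
  qed
  have Vl: "u (vc y) - \<alpha> * hf y = lam" if "y \<in> Ec - E" for y
    using boundary_cases[OF that] hf_circ[of y] l1[of y] l2[of y] lam2 by (auto simp: lam_def)
  have limV: "((\<lambda>z. (u (vc z) - \<alpha> * hf z) - Hc z) \<longlongrightarrow> 0) at_infinity"
  proof -
    have "((\<lambda>z. (u (vc z) - Hc z) - \<alpha> * hf z) \<longlongrightarrow> 0 - \<alpha> * 0) at_infinity"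
      by (intro tendsto_intros lim hf_lim)
    then show ?thesis
      by (simp add: algebra_simps)
  qed
  have cV: "continuous_on Ec (\<lambda>z. u (vc z) - \<alpha> * hf z)"
    by (intro continuous_intros cu continuous_hf)
  have vb: "norm (f z - of_real \<alpha> * hder z) \<le> ?C1"
    by (rule equal_potential_gradient_bound[OF r1 r2 V[unfolded E_def] cV[unfolded Ec_def]
          Vl[unfolded E_def Ec_def] Hh limV Hm R z(1)[unfolded E_def] z(2)])
  have pR: "norm p1 \<le> R" "norm p2 \<le> R"
    using p_in_disc R norm_triangle_sub[of p1 c1] norm_triangle_sub[of p2 c2] by (auto simp: dist_norm)
  have seg: "norm w \<le> R" if "w \<in> closed_segment p1 p2" for w
  proof -
    have "closed_segment p1 p2 \<subseteq> cball 0 R"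
      by (rule closed_segment_subset) (use pR in auto)
    then show ?thesis
      using that by auto
  qed
  have qs: "q \<in> closed_segment p1 p2"
    unfolding q by (rule midpt_in_segment)
  have pp: "p2 - p1 = of_real (2 * \<tau>) * e"
    by (simp add: p1_def p2_def)
  have npp: "norm (p2 - p1) = 2 * \<tau>"
    unfolding pp using e \<tau> by (simp add: norm_mult)
  obtain G where G: "\<And>z. Hc z = Re (G z)" "\<And>z. (G has_field_derivative fH z) (at z)"
    by (rule harm_deriv_primitive[OF Hh, of UNIV]) auto
  have "norm ((G p2 - fH q * p2) - (G p1 - fH q * p1)) \<le> B2 * (2 * \<tau>) * norm (p2 - p1)"
  proof (rule field_differentiable_bound[where S = "closed_segment p1 p2"])
    show "((\<lambda>w. G w - fH q * w) has_field_derivative (fH w - fH q)) (at w within closed_segment p1 p2)" for w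
      by (rule has_field_derivative_at_within) (auto intro!: derivative_eq_intros G(2))
    show "norm (fH w - fH q) \<le> B2 * (2 * \<tau>)" if w: "w \<in> closed_segment p1 p2" for w
    proof -
      have "norm (w - q) \<le> 2 * \<tau>"
      proof -
        have "closed_segment p1 p2 \<subseteq> cball q (2 * \<tau>)"
          using segment_bound[OF qs] npp by (intro closed_segment_subset) (auto simp: dist_norm)
        then show ?thesis
          using w by (auto simp: dist_norm norm_minus_commute)
      qed
      then show ?thesis
        using H2[OF seg[OF w] seg[OF qs]] B2 by (meson mult_left_mono order_trans)
    qed
  qed auto
  also have "(G p2 - fH q * p2) - (G p1 - fH q * p1) = G p2 - G p1 - fH q * (p2 - p1)"
    by (simp add: algebra_simps)
  finally have "norm (G p2 - G p1 - fH q * (p2 - p1)) \<le> 4 * B2 * \<tau>\<^sup>2"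
    by (simp add: npp power2_eq_square)
  moreover have "Re (G p2 - G p1 - fH q * (p2 - p1)) = \<Delta> - 2 * \<tau> * D"
    by (simp add: \<Delta>_def D_def G(1) pp algebra_simps)
  ultimately have \<Delta>: "\<bar>\<Delta> - 2 * \<tau> * D\<bar> \<le> 4 * B2 * \<tau>\<^sup>2"
    by (metis abs_Re_le_cmod order_trans)
  have D: "\<bar>D\<bar> \<le> B1"
  proof -
    have "\<bar>D\<bar> \<le> norm (e * fH q)"
      unfolding D_def by (rule abs_Re_le_cmod)
    also have "\<dots> \<le> B1"
      using H1[OF seg[OF qs]] e by (simp add: norm_mult)
    finally show ?thesis .
  qed
  define K where "K = 4 * B2 * L + B1 * (1 / r1\<^sup>2 + 1 / r2\<^sup>2) * L * (r1 * r2 / (r1 + r2))"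
  have \<alpha>a: "\<bar>\<alpha> - a\<bar> \<le> 2 * pi * K * \<tau>"
    unfolding \<alpha>_def a K_def D_def[symmetric]
    by (rule coefficient_estimate[OF AL \<Delta> D]) (use B2 in simp)
  have "norm (of_real (\<alpha> - a) * hder z) \<le> (2 * pi * K * \<tau>) * ((L + r1 + r2) / (pi * min r1 r2 * \<tau>))"
    unfolding norm_mult norm_of_real
    by (intro mult_mono \<alpha>a hder_bound[OF z(1) AL] order_trans[OF abs_ge_zero \<alpha>a]) simp
  also have "\<dots> = 2 * K * (L + r1 + r2) / min r1 r2"
    using \<tau> by simp
  finally have hb: "norm (of_real (\<alpha> - a) * hder z) \<le> ?C2"
    by (simp add: K_def L_def)
  have "f z - of_real a * hder z = (f z - of_real \<alpha> * hder z) + of_real (\<alpha> - a) * hder z"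
    by (simp add: algebra_simps)
  then have "norm (f z - of_real a * hder z) \<le> norm (f z - of_real \<alpha> * hder z) + norm (of_real (\<alpha> - a) * hder z)"
    using norm_triangle_ineq by metis
  then show ?thesis
    using vb hb by linarith
qed

end

lemma two_discs_normal_form:
  fixes a b :: complex
  assumes r: "r1 > 0" "r2 > 0" and d: "dist a b > r1 + r2"
  obtains \<tau> m e where "two_discs r1 r2 \<tau> e" "two_discs.c1 r1 \<tau> m e = a" "two_discs.c2 r2 \<tau> m e = b"
proof -
  define d where "d = dist a b"
  define s where "s = (d\<^sup>2 + r1\<^sup>2 - r2\<^sup>2) / (2 * d)"
  define \<tau> where "\<tau> = sqrt (s\<^sup>2 - r1\<^sup>2)"
  define e where "e = (b - a) / of_real d"
  define m where "m = a + of_real s * e"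
  have d0: "d > 0" "d > r1 + r2"
    using r assms(3) by (auto simp: d_def)
  have gt1: "s > r1"
  proof -
    have "r2\<^sup>2 < (d - r1)\<^sup>2"
      using d0 r by (intro power_strict_mono) auto
    then show ?thesis
      using d0 by (simp add: s_def field_simps power2_eq_square)
  qed
  have gt2: "d - s > r2"
  proof -
    have "r1\<^sup>2 < (d - r2)\<^sup>2"
      using d0 r by (intro power_strict_mono) auto
    then show ?thesis
      using d0 by (simp add: s_def field_simps power2_eq_square)
  qed
  have "r1\<^sup>2 < s\<^sup>2"
    using gt1 r by (intro power_strict_mono) auto
  then have \<tau>: "\<tau> > 0" "\<tau>\<^sup>2 = s\<^sup>2 - r1\<^sup>2"
    by (simp_all add: \<tau>_def)
  have "(d - s)\<^sup>2 - s\<^sup>2 = r2\<^sup>2 - r1\<^sup>2"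
    using d0 by (simp add: s_def field_simps power2_eq_square)
  then have sq: "\<tau>\<^sup>2 + r1\<^sup>2 = s\<^sup>2" "\<tau>\<^sup>2 + r2\<^sup>2 = (d - s)\<^sup>2"
    using \<tau> by auto
  have "norm e = 1"
    using d0 by (simp add: e_def norm_divide d_def dist_norm norm_minus_commute)
  then have l: "two_discs r1 r2 \<tau> e"
    using r \<tau> by unfold_locales
  have "two_discs.A1 r1 \<tau> = s" "two_discs.A2 r2 \<tau> = d - s"
    unfolding two_discs.A1_def[OF l] two_discs.A2_def[OF l] sq using gt1 gt2 r by auto
  moreover have "of_real d * e = b - a"
    using d0 by (simp add: e_def)
  ultimately have "two_discs.c1 r1 \<tau> m e = a" "two_discs.c2 r2 \<tau> m e = b"
    unfolding two_discs.c1_def[OF l] two_discs.c2_def[OF l] m_def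
    by (simp_all add: left_diff_distrib)
  then show thesis
    by (rule that[OF l])
qed

lemma continuous_bounded_cball:
  fixes g :: "complex \<Rightarrow> 'b::real_normed_vector"
  assumes "continuous_on UNIV g"
  shows "\<exists>B. \<forall>z. norm z \<le> \<rho> \<longrightarrow> norm (g z) \<le> B"
proof -
  have "bounded (g ` cball 0 \<rho>)"
    by (intro compact_imp_bounded compact_continuous_image continuous_on_subset[OF assms]) auto
  then show ?thesis
    unfolding bounded_iff by (metis image_eqI mem_cball_0)
qed

theorem theorem2p1:
  fixes r1 r2 :: real and H :: "real^2 \<Rightarrow> real" and \<Omega> :: "(real^2) set"
  assumes "r1 > 0" and "r2 > 0" and "harmonic_on H UNIV" and "bounded \<Omega>"
  shows "\<exists>C. \<forall>\<epsilon> c1 c2 u lam1 lam2.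
     \<epsilon> > 0 \<and> dist c1 c2 = r1 + r2 + \<epsilon>
     \<and> cball c1 r1 \<subseteq> \<Omega> \<and> cball c2 r2 \<subseteq> \<Omega>
     \<and> harmonic_on u {x. dist x c1 > r1 \<and> dist x c2 > r2}
     \<and> continuous_on {x. dist x c1 \<ge> r1 \<and> dist x c2 \<ge> r2} u
     \<and> (\<forall>x. dist x c1 = r1 \<longrightarrow> u x = lam1)
     \<and> (\<forall>x. dist x c2 = r2 \<longrightarrow> u x = lam2)
     \<and> (\<exists>M R. \<forall>x. norm x \<ge> R \<longrightarrow> \<bar>u x - H x\<bar> \<le> M / norm x)
     \<and> zero_flux u c1 r1 \<and> zero_flux u c2 r2
     \<longrightarrow> (\<forall>x\<in>\<Omega>. dist x c1 > r1 \<and> dist x c2 > r2 \<longrightarrow>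
            norm (grad (\<lambda>y. u y - coef_a r1 r2 c1 c2 H *
                        hfun (fixpt1 c1 r1 c2 r2) (fixpt2 c1 r1 c2 r2) y) x) \<le> C)"
proof -
  define Hc where "Hc = (\<lambda>z. H (vc z))"
  obtain fH where Hh: "harm_deriv Hc fH UNIV"
    using harmonic_on_imp_harm_deriv[OF assms(3)] unfolding Hc_def by auto
  obtain R where R: "\<And>x. x \<in> \<Omega> \<Longrightarrow> norm x \<le> R"
    using assms(4) by (auto simp: bounded_iff)
  have fH: "fH holomorphic_on UNIV"
    using Hh by (simp add: harm_deriv_def)
  obtain Hm where Hm: "\<And>z. norm z \<le> R + 1 \<Longrightarrow> \<bar>Hc z\<bar> \<le> Hm"
    using continuous_bounded_cball[OF harm_deriv_continuous_on[OF Hh], of "R + 1"] by auto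
  obtain B1 where B1: "\<And>z. norm z \<le> R \<Longrightarrow> norm (fH z) \<le> B1"
    using continuous_bounded_cball[OF holomorphic_on_imp_continuous_on[OF fH], of R] by auto
  have "deriv fH holomorphic_on UNIV"
    using fH by (rule holomorphic_deriv) simp
  then obtain B2 where B2: "\<And>z. norm z \<le> R \<Longrightarrow> norm (deriv fH z) \<le> B2"
    using continuous_bounded_cball[OF holomorphic_on_imp_continuous_on, of "deriv fH" R] by auto
  have Lip: "norm (fH z - fH w) \<le> max 0 B2 * norm (z - w)" if "norm z \<le> R" "norm w \<le> R" for z w
  proof (rule field_differentiable_bound[where S = "cball 0 R" and f' = "deriv fH"])
    show "(fH has_field_derivative deriv fH x) (at x within cball 0 R)" for x
      using holomorphic_derivI[OF fH open_UNIV] by (simp add: has_field_derivative_at_within)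
  qed (use that B2 in \<open>auto simp: le_max_iff_disj\<close>)
  show ?thesis
  proof (intro exI allI impI ballI; elim conjE exE)
    fix \<epsilon> c1 c2 u lam1 lam2 x M R'
    assume \<epsilon>: "\<epsilon> > 0" and dc: "dist c1 c2 = r1 + r2 + \<epsilon>"
      and cb: "cball c1 r1 \<subseteq> \<Omega>" "cball c2 r2 \<subseteq> \<Omega>"
      and hu: "harmonic_on u {x. dist x c1 > r1 \<and> dist x c2 > r2}"
      and cu: "continuous_on {x. dist x c1 \<ge> r1 \<and> dist x c2 \<ge> r2} u"
      and l1: "\<forall>x. dist x c1 = r1 \<longrightarrow> u x = lam1" and l2: "\<forall>x. dist x c2 = r2 \<longrightarrow> u x = lam2"
      and dec: "\<forall>x. norm x \<ge> R' \<longrightarrow> \<bar>u x - H x\<bar> \<le> M / norm x"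
      and flux: "zero_flux u c1 r1"
      and x: "x \<in> \<Omega>" "r1 < dist x c1" "r2 < dist x c2"
    have "dist (cx c1) (cx c2) > r1 + r2"
      using dc \<epsilon> by simp
    then obtain \<tau> m e where l: "two_discs r1 r2 \<tau> e"
      and c: "two_discs.c1 r1 \<tau> m e = cx c1" "two_discs.c2 r2 \<tau> m e = cx c2"
      using two_discs_normal_form[OF assms(1,2)] by blast
    interpret two_discs r1 r2 \<tau> m e
      by (rule l)
    have dist_vcx: "dist (vc z) y = dist z (cx y)" for z y
      by (metis dist_vc vc_cx)
    have vc12: "vc (cx c1) = c1" "vc (cx c2) = c2"
      by simp_all
    note eqs = fixpt1_eq[unfolded c vc12] fixpt2_eq[unfolded c vc12] midpt_eq[unfolded c vc12]
    have "vc -` {x. dist x c1 > r1 \<and> dist x c2 > r2} = E"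
      by (auto simp: E_def c dist_vcx)
    then obtain f where f: "harm_deriv (\<lambda>z. u (vc z)) f E"
      using harmonic_on_imp_harm_deriv[OF hu] by metis
    define q where "q = cx (midpt c1 r1 c2 r2)"
    define a where "a = coef_a r1 r2 c1 c2 H"
    have "cx (grad H (midpt c1 r1 c2 r2)) = cnj (fH q)"
      unfolding q_def by (rule harm_deriv_grad[OF Hh[unfolded Hc_def]]) simp
    then have a: "a = 4 * pi * r1 * r2 / (r1 + r2) * Re (e * fH q)"
      unfolding a_def coef_a_def eqs inner_eq_Re_cx nvec_eq by simp
    have xE: "cx x \<in> E"
      using x by (simp add: E_def c)
    have "norm (f (cx x) - of_real a * hder (cx x)) \<le>
       8 * exp 2 * Hm * (1 + 2 / (r1 * ln (1 + 1 / r1)) + 2 / (r2 * ln (1 + 1 / r2)))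
       + 2 * (4 * max 0 B2 * (2 * R) + B1 * (1 / r1\<^sup>2 + 1 / r2\<^sup>2) * (2 * R) * (r1 * r2 / (r1 + r2)))
           * (2 * R + r1 + r2) / min r1 r2"
    proof (rule gradient_bound[OF Hh f _ _ _ _ _ _ _ Hm B1 Lip _ xE])
      show "continuous_on Ec (\<lambda>z. u (vc z))"
        by (rule continuous_on_compose2[OF cu linear_continuous_on[OF bounded_linear_vc]])
           (auto simp: Ec_def c dist_vcx)
      show "((\<lambda>z. u (vc z) - Hc z) \<longlongrightarrow> 0) at_infinity"
      proof (rule Lim_null_comparison)
        show "eventually (\<lambda>z. norm (u (vc z) - Hc z) \<le> M / norm z) at_infinity"
          unfolding eventually_at_infinity Hc_def using dec by (metis norm_vc real_norm_def)
        show "((\<lambda>z::complex. M / norm z) \<longlongrightarrow> 0) at_infinity"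
          by (rule tendsto_divide_0[OF tendsto_const])
             (rule filterlim_at_top_imp_at_infinity[OF filterlim_norm_at_top])
      qed
      show "zero_flux u (vc local.c1) r1"
        using flux by (simp add: c)
      have "cball c1 r1 \<subseteq> cball 0 R" "cball c2 r2 \<subseteq> cball 0 R"
        using cb R by auto
      then have "norm c1 + r1 \<le> R" "norm c2 + r2 \<le> R"
        using assms(1,2) by (auto simp: cball_subset_cball_iff)
      then show "norm local.c1 + r1 \<le> R" "norm local.c2 + r2 \<le> R"
        by (simp_all add: c)
      show "q = m + of_real (((A2 - r2) - (A1 - r1)) / 2) * e"
        unfolding q_def eqs ..
    qed (use l1 l2 a R x in \<open>auto simp: c dist_vcx\<close>)
    moreover have "norm (grad (\<lambda>y. u y - a * hfun (fixpt1 c1 r1 c2 r2) (fixpt2 c1 r1 c2 r2) y) x)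
        = norm (f (cx x) - of_real a * hder (cx x))"
    proof -
      have dist_sub: "norm (vc z - vc p) = norm (z - p)" for z p
        by (metis dist_norm dist_vc)
      have "harm_deriv (\<lambda>z. u (vc z) - a * hf z) (\<lambda>z. f z - of_real a * hder z) E"
        by (intro harm_deriv_diff harm_deriv_cmult harm_deriv_hf f)
      moreover have "hf z = hfun (fixpt1 c1 r1 c2 r2) (fixpt2 c1 r1 c2 r2) (vc z)" for z
        by (simp add: hf_def hfun_def eqs dist_sub)
      ultimately have "harm_deriv (\<lambda>z. u (vc z) - a * hfun (fixpt1 c1 r1 c2 r2) (fixpt2 c1 r1 c2 r2) (vc z))
          (\<lambda>z. f z - of_real a * hder z) E"
        by simp
      from harm_deriv_grad[OF this xE] show ?thesis
        by (metis complex_mod_cnj norm_cx)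
    qed
    ultimately show "norm (grad (\<lambda>y. u y - coef_a r1 r2 c1 c2 H * hfun (fixpt1 c1 r1 c2 r2) (fixpt2 c1 r1 c2 r2) y) x)
      \<le> 8 * exp 2 * Hm * (1 + 2 / (r1 * ln (1 + 1 / r1)) + 2 / (r2 * ln (1 + 1 / r2)))
       + 2 * (4 * max 0 B2 * (2 * R) + B1 * (1 / r1\<^sup>2 + 1 / r2\<^sup>2) * (2 * R) * (r1 * r2 / (r1 + r2)))
           * (2 * R + r1 + r2) / min r1 r2"
      unfolding a_def by simp
  qed
qed

end
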